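(* Let $\omega$ be a weight function, let $\overline{\omega}=\{\lambda\omega : \lambda>0\}$ be its class, and let $H: f \mapsto (\langle f, h_n\rangle)_{n\in\mathbb{N}}$ be the Hermite coefficient map. (1) If $\limsup_{t\to\infty} \frac{\omega(t)}{t^2} < \infty$, then $H$ is a tame isomorphism $\mathcal{S}_{\{\overline{\omega}\}} \to \Lambda_{\{\overline{\omega}\}}$. (2) If $\limsup_{t\to\infty} \frac{\omega(t)}{t^2} = 0$, then $H$ is a tame isomorphism $\mathcal{S}_{(\overline{\omega})} \to \Lambda_{(\overline{\omega})}$.
   Context: Weight function: a continuous increasing function $\omega:[0,\infty)\to[0,\infty)$ such that (i) $t\mapsto\omega(e^t)$ is convex; (ii) $\log t = o(\omega(t))$ as $t\to\infty$; (iii) $\omega(2t)=O(\omega(t))$ as $t\to\infty$; (iv) $\limsup_{t\to\infty}\omega(t)/t^2\le \frac12$. Fourier transform: $\widehat f(\xi)=(2\pi)^{-1/2}\int f(x)e^{-i\xi x}\,dx$. Inner product: that of the complex space $L^2(\mathbb{R})$, linear in the first variable. Hermite functions: $h_m(x)=(2^m m!\sqrt\pi)^{-1/2}H_m(x)e^{-x^2/2}$ with $H_m(x)=(-1)^m e^{x^2}\frac{d^m}{dx^m}e^{-x^2}$, an orthonormal basis of $L^2(\mathbb{R})$. $\mathbb{N}=\{0,1,2,\dots\}$. Function spaces: for $\lambda>0$, $\mathcal{S}_{\lambda\omega}$ is the Banach space of $f\in L^2(\mathbb{R})$ with $f(x)=O(e^{-\lambda\omega(|x|)})$ and $\widehat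 f(\xi)=O(e^{-\lambda\omega(|\xi|)})$, with norm $\|f\|_{\lambda\omega}=\|f(x)e^{\lambda\omega(|x|)}\|_\infty+\|\widehat f(\xi)e^{\lambda\omega(|\xi|)}\|_\infty$. Put $\mathcal{S}_{\{\overline\omega\}}=\bigcup_{\epsilon>0}\mathcal{S}_{\epsilon\omega}$ (locally convex inductive limit topology) and $\mathcal{S}_{(\overline\omega)}=\bigcap_{N<\infty}\mathcal{S}_{N\omega}$ (projective topology). Sequence spaces: for $\lambda>0$, $\Lambda_{\lambda\omega}$ is the Banach space of $(\alpha_n)\in\mathbb{C}^{\mathbb{N}}$ with $\alpha_n=O(e^{-\lambda\omega(\sqrt n)})$, with norm $\|(\alpha_n)\|_{\lambda\omega}=\sup_n|\alpha_n|e^{\lambda\omega(\sqrt n)}$. Put $\Lambda_{\{\overline\omega\}}=\bigcup_{\epsilon>0}\Lambda_{\epsilon\omega}$ and $\Lambda_{(\overline\omega)}=\bigcap_{N<\infty}\Lambda_{N\omega}$, with the inductive and projective topologies respectively. Tameness. Inductive case: for increasing families of Banach spaces $(E_j,|\cdot|_j)$, $(F_j,\|\cdot\|_j)$ with $E=\bigcup_j E_j$, $F=\bigcup_j F_j$, a linear map $T:E\to F$ is tame if there are $j_0\in\mathbb{N}$ and $\overline{C}<\infty$ such that for all $j\ge j_0$ there is $C<\infty$ with $\|T(f)\|_{\overline{C}j}\le C|f|_j$ (for all $f\in E_j$). Projective case: for decreasing families with $E=\bigcap_j E_j$, $F=\bigcap_j F_j$, a linear map $T:E\to F$ is tame if there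 are $j_0\in\mathbb{N}$ and $\overline{C}<\infty$ such that for all $j\ge j_0$ there is $C<\infty$ with $\|T(f)\|_j\le C|f|_{\overline{C}j}$ (for all $f\in E$). A tame isomorphism is a bijective linear map $T$ such that both $T$ and $T^{-1}$ are tame. For the spaces of type $\{\overline\omega\}$ the inductive definition is used with the families $\mathcal{S}_{\omega/j}$ and $\Lambda_{\omega/j}$ ($j\ge1$) and their norms $\|\cdot\|_{\omega/j}$; for the spaces of type $(\overline\omega)$ the projective definition is used with the families $\mathcal{S}_{j\omega}$ and $\Lambda_{j\omega}$ ($j\ge 1$) and their norms $\|\cdot\|_{j\omega}$. *)

theory Defs
  imports
    "HOL-Analysis.Analysis"
    "HOL-Probability.Essential_Supremum"
    "HOL-Probability.Distributions"
    "HOL-Library.Landau_Symbols"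
    "HOL-Library.Function_Algebras"
begin

section \<open>Weight functions\<close>

text \<open>Only the values of \<open>\<omega>\<close> on the half-line \<open>[0, \<infinity>)\<close> matter.
  ``Increasing'' is read in the weak sense.\<close>

definition weight_function :: "(real \<Rightarrow> real) \<Rightarrow> bool" where
  "weight_function \<omega> \<longleftrightarrow>
     continuous_on {0..} \<omega> \<and> mono_on {0..} \<omega> \<and> (\<forall>t\<ge>0. 0 \<le> \<omega> t) \<and>
     convex_on UNIV (\<lambda>t. \<omega> (exp t)) \<and>
     ln \<in> o[at_top](\<omega>) \<and>
     (\<lambda>t. \<omega> (2 * t)) \<in> O[at_top](\<omega>) \<and>
     Limsup at_top (\<lambda>t. ereal (\<omega> t / t\<^sup>2)) \<le> ereal (1 / 2)"


section \<open>Complex vector spaces\<close>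

class complex_vs = ab_group_add +
  fixes cscale :: "complex \<Rightarrow> 'a \<Rightarrow> 'a"
  assumes cscale_add_right: "cscale a (x + y) = cscale a x + cscale a y"
    and cscale_add_left: "cscale (a + b) x = cscale a x + cscale b x"
    and cscale_cscale: "cscale a (cscale b x) = cscale (a * b) x"
    and cscale_one: "cscale 1 x = x"

instantiation complex :: complex_vs
begin
definition cscale_complex :: "complex \<Rightarrow> complex \<Rightarrow> complex" where
  "cscale_complex a x = a * x"
instance
  by standard (auto simp: cscale_complex_def algebra_simps)
end

instantiation "fun" :: (type, complex_vs) complex_vs
begin
definition cscale_fun :: "complex \<Rightarrow> ('a \<Rightarrow> 'b) \<Rightarrow> 'a \<Rightarrow> 'b" where
  "cscale_fun a f = (\<lambda>x. cscale a (f x))"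
instance
  by standard
    (auto simp: cscale_fun_def fun_eq_iff cscale_add_right cscale_add_left cscale_cscale cscale_one)
end

definition clinear_between :: "'a::complex_vs set \<Rightarrow> 'b::complex_vs set \<Rightarrow> ('a \<Rightarrow> 'b) \<Rightarrow> bool" where
  "clinear_between E F T \<longleftrightarrow>
     (\<forall>x\<in>E. T x \<in> F) \<and>
     (\<forall>x\<in>E. \<forall>y\<in>E. T (x + y) = T x + T y) \<and>
     (\<forall>c. \<forall>x\<in>E. T (cscale c x) = cscale c (T x))"


section \<open>Tame maps\<close>

text \<open>A graded space is given by its total space \<open>E\<close>, its steps \<open>Ej j\<close> and their norms
  \<open>nE j\<close>, for \<open>j \<ge> 1\<close>; the index \<open>0\<close> is never used. As \<open>C' * j\<close> has to be an
  index for every large \<open>j\<close>, the constant \<open>C'\<close> is a positive natural number. Since the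
  norms are total functions, the membership of \<open>T f\<close> in the step whose norm is estimated is
  stated explicitly in the inductive case.\<close>

definition tame_inductive ::
  "'a::complex_vs set \<Rightarrow> (nat \<Rightarrow> 'a set) \<Rightarrow> (nat \<Rightarrow> 'a \<Rightarrow> real) \<Rightarrow>
   'b::complex_vs set \<Rightarrow> (nat \<Rightarrow> 'b set) \<Rightarrow> (nat \<Rightarrow> 'b \<Rightarrow> real) \<Rightarrow> ('a \<Rightarrow> 'b) \<Rightarrow> bool" where
  "tame_inductive E Ej nE F Fj nF T \<longleftrightarrow>
     clinear_between E F T \<and>
     (\<exists>j0\<ge>1. \<exists>C'\<ge>1. \<forall>j\<ge>j0. \<exists>C. \<forall>f\<in>Ej j.
        T f \<in> Fj (C' * j) \<and> nF (C' * j) (T f) \<le> C * nE j f)"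

definition tame_projective ::
  "'a::complex_vs set \<Rightarrow> (nat \<Rightarrow> 'a \<Rightarrow> real) \<Rightarrow>
   'b::complex_vs set \<Rightarrow> (nat \<Rightarrow> 'b \<Rightarrow> real) \<Rightarrow> ('a \<Rightarrow> 'b) \<Rightarrow> bool" where
  "tame_projective E nE F nF T \<longleftrightarrow>
     clinear_between E F T \<and>
     (\<exists>j0\<ge>1. \<exists>C'\<ge>1. \<forall>j\<ge>j0. \<exists>C. \<forall>f\<in>E. nF j (T f) \<le> C * nE (C' * j) f)"

definition tame_iso_inductive ::
  "'a::complex_vs set \<Rightarrow> (nat \<Rightarrow> 'a set) \<Rightarrow> (nat \<Rightarrow> 'a \<Rightarrow> real) \<Rightarrow>
   'b::complex_vs set \<Rightarrow> (nat \<Rightarrow> 'b set) \<Rightarrow> (nat \<Rightarrow> 'b \<Rightarrow> real) \<Rightarrow> ('a \<Rightarrow> 'b) \<Rightarrow> bool" where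
  "tame_iso_inductive E Ej nE F Fj nF T \<longleftrightarrow>
     bij_betw T E F \<and>
     tame_inductive E Ej nE F Fj nF T \<and>
     tame_inductive F Fj nF E Ej nE (inv_into E T)"

definition tame_iso_projective ::
  "'a::complex_vs set \<Rightarrow> (nat \<Rightarrow> 'a \<Rightarrow> real) \<Rightarrow>
   'b::complex_vs set \<Rightarrow> (nat \<Rightarrow> 'b \<Rightarrow> real) \<Rightarrow> ('a \<Rightarrow> 'b) \<Rightarrow> bool" where
  "tame_iso_projective E nE F nF T \<longleftrightarrow>
     bij_betw T E F \<and>
     tame_projective E nE F nF T \<and>
     tame_projective F nF E nE (inv_into E T)"


section \<open>The space \<open>L\<^sup>2(\<real>)\<close>\<close>

definition square_integrable :: "(real \<Rightarrow> complex) \<Rightarrow> bool" where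
  "square_integrable f \<longleftrightarrow>
     f \<in> borel_measurable lborel \<and> integrable lborel (\<lambda>x. (cmod (f x))\<^sup>2)"

definition l2_rel :: "(real \<Rightarrow> complex) \<Rightarrow> (real \<Rightarrow> complex) \<Rightarrow> bool" where
  "l2_rel f g \<longleftrightarrow> square_integrable f \<and> square_integrable g \<and> (AE x in lborel. f x = g x)"

lemma square_integrable_measurable [measurable_dest]:
  "square_integrable f \<Longrightarrow> f \<in> borel_measurable lborel"
  by (simp add: square_integrable_def)

lemma square_integrable_zero: "square_integrable (\<lambda>x. 0)"
  by (simp add: square_integrable_def)

lemma square_integrable_scale:
  assumes "square_integrable f"
  shows "square_integrable (\<lambda>x. c * f x)"
  using assms by (auto simp: square_integrable_def norm_mult power_mult_distrib)

lemma square_integrable_add: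
  assumes "square_integrable f" "square_integrable g"
  shows "square_integrable (\<lambda>x. f x + g x)"
proof -
  have [measurable]: "f \<in> borel_measurable lborel" "g \<in> borel_measurable lborel"
    using assms by (auto simp: square_integrable_def)
  have *: "(cmod (f x + g x))\<^sup>2 \<le> 2 * (cmod (f x))\<^sup>2 + 2 * (cmod (g x))\<^sup>2" for x
  proof -
    have "(cmod (f x + g x))\<^sup>2 \<le> (cmod (f x) + cmod (g x))\<^sup>2"
      by (intro power_mono norm_triangle_ineq) auto
    also have "\<dots> \<le> 2 * (cmod (f x))\<^sup>2 + 2 * (cmod (g x))\<^sup>2"
      using sum_squares_bound[of "cmod (f x)" "cmod (g x)"]
      by (simp add: power2_sum)
    finally show ?thesis .
  qed
  have "integrable lborel (\<lambda>x. 2 * (cmod (f x))\<^sup>2 + 2 * (cmod (g x))\<^sup>2)"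
    using assms by (auto simp: square_integrable_def)
  then have "integrable lborel (\<lambda>x. (cmod (f x + g x))\<^sup>2)"
    by (rule Bochner_Integration.integrable_bound) (use * in auto)
  then show ?thesis
    by (simp add: square_integrable_def)
qed

quotient_type l2 = "real \<Rightarrow> complex" / partial: l2_rel
proof (rule part_equivpI)
  show "\<exists>f. l2_rel f f"
    using square_integrable_zero by (auto simp: l2_rel_def)
  show "symp l2_rel"
    by (rule sympI) (auto simp: l2_rel_def elim: eventually_mono)
  show "transp l2_rel"
    by (rule transpI) (auto simp: l2_rel_def elim: eventually_elim2)
qed

instantiation l2 :: complex_vs
begin

lift_definition zero_l2 :: l2 is "\<lambda>x. 0"
  by (simp add: l2_rel_def square_integrable_zero)

lift_definition plus_l2 :: "l2 \<Rightarrow> l2 \<Rightarrow> l2" is "\<lambda>f g x. f x + g x"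
  by (auto simp: l2_rel_def intro: square_integrable_add elim: eventually_elim2)

lift_definition cscale_l2 :: "complex \<Rightarrow> l2 \<Rightarrow> l2" is "\<lambda>c f x. c * f x"
  by (auto simp: l2_rel_def intro: square_integrable_scale elim: eventually_mono)

definition uminus_l2 :: "l2 \<Rightarrow> l2" where "uminus_l2 f = cscale (-1) f"

definition minus_l2 :: "l2 \<Rightarrow> l2 \<Rightarrow> l2" where "minus_l2 f g = f + - (g::l2)"

instance
proof
  fix f g h :: l2 and a b :: complex
  show "f + g + h = f + (g + h)"
    by transfer (auto simp: l2_rel_def add.assoc intro!: square_integrable_add)
  show "f + g = g + f"
    by transfer (auto simp: l2_rel_def add.commute intro!: square_integrable_add)
  show "0 + f = f"
    by transfer (auto simp: l2_rel_def)
  show "- f + f = 0"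
    unfolding uminus_l2_def
    by transfer (auto simp: l2_rel_def square_integrable_zero)
  show "f - g = f + - g"
    by (simp add: minus_l2_def)
  show "cscale a (f + g) = cscale a f + cscale a g"
    by transfer (auto simp: l2_rel_def distrib_left
        intro!: square_integrable_add square_integrable_scale)
  show "cscale (a + b) f = cscale a f + cscale b f"
    by transfer (auto simp: l2_rel_def distrib_right
        intro!: square_integrable_add square_integrable_scale)
  show "cscale a (cscale b f) = cscale (a * b) f"
    by transfer (auto simp: l2_rel_def mult.assoc intro!: square_integrable_scale)
  show "cscale 1 f = f"
    by transfer (auto simp: l2_rel_def)
qed

end

lift_definition l2_inner :: "l2 \<Rightarrow> l2 \<Rightarrow> complex"
  is "\<lambda>f g. \<integral>x. f x * cnj (g x) \<partial>lborel"
proof -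
  fix f f' g g' assume "l2_rel f f'" "l2_rel g g'"
  then have [measurable]: "f \<in> borel_measurable borel" "f' \<in> borel_measurable borel"
      "g \<in> borel_measurable borel" "g' \<in> borel_measurable borel"
    and "AE x in lborel. f x = f' x" "AE x in lborel. g x = g' x"
    by (auto simp: l2_rel_def square_integrable_def)
  have [measurable]: "cnj \<in> borel_measurable borel"
    by (intro borel_measurable_continuous_onI continuous_intros)
  have "AE x in lborel. f x * cnj (g x) = f' x * cnj (g' x)"
    using \<open>AE x in lborel. f x = f' x\<close> \<open>AE x in lborel. g x = g' x\<close> by eventually_elim simp
  then show "(\<integral>x. f x * cnj (g x) \<partial>lborel) = (\<integral>x. f' x * cnj (g' x) \<partial>lborel)"
    by (intro integral_cong_AE) auto
qed

text \<open>The Fourier transform as an absolutely convergent integral. It is applied only to classes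
  with \<open>f(x) = O(e\<^bsup>-\<lambda>\<omega>(|x|)\<^esup>)\<close>, \<open>\<lambda> > 0\<close>, which are integrable because \<open>log t = o(\<omega>(t))\<close>.\<close>

lift_definition l2_fourier :: "l2 \<Rightarrow> real \<Rightarrow> complex"
  is "\<lambda>f \<xi>. complex_of_real (1 / sqrt (2 * pi)) *
          (\<integral>x. f x * exp (- \<i> * complex_of_real (\<xi> * x)) \<partial>lborel)"
proof (rule ext)
  fix f g :: "real \<Rightarrow> complex" and \<xi> :: real
  assume "l2_rel f g"
  then have [measurable]: "f \<in> borel_measurable borel" "g \<in> borel_measurable borel"
    and ae: "AE x in lborel. f x = g x"
    by (auto simp: l2_rel_def square_integrable_def)
  have "AE x in lborel. f x * exp (- \<i> * complex_of_real (\<xi> * x)) =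
      g x * exp (- \<i> * complex_of_real (\<xi> * x))"
    using ae by eventually_elim simp
  then show "complex_of_real (1 / sqrt (2 * pi)) *
        (\<integral>x. f x * exp (- \<i> * complex_of_real (\<xi> * x)) \<partial>lborel) =
      complex_of_real (1 / sqrt (2 * pi)) *
        (\<integral>x. g x * exp (- \<i> * complex_of_real (\<xi> * x)) \<partial>lborel)"
    by (intro arg_cong2[where f = "(*)"] integral_cong_AE refl) auto
qed

lift_definition l2_ae_bounded :: "(real \<Rightarrow> real) \<Rightarrow> l2 \<Rightarrow> bool"
  is "\<lambda>b f. \<exists>C. AE x in lborel. cmod (f x) \<le> C * b x"
proof -
  fix b and f g :: "real \<Rightarrow> complex"
  assume "l2_rel f g"
  then have ae: "AE x in lborel. f x = g x"
    by (simp add: l2_rel_def)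
  have "(AE x in lborel. cmod (f x) \<le> C * b x) \<longleftrightarrow> (AE x in lborel. cmod (g x) \<le> C * b x)" for C
    by (rule eventually_cong[OF ae]) simp
  then show "(\<exists>C. AE x in lborel. cmod (f x) \<le> C * b x) \<longleftrightarrow>
      (\<exists>C. AE x in lborel. cmod (g x) \<le> C * b x)"
    by simp
qed

lemma ae_eq_measurable_lebesgue:
  fixes F G :: "real \<Rightarrow> ereal"
  assumes eq: "AE x in lebesgue. F x = G x" and F: "F \<in> borel_measurable lebesgue"
  shows "G \<in> borel_measurable lebesgue"
proof (rule measurableI)
  fix A :: "ereal set" assume A: "A \<in> sets borel"
  show "G -` A \<inter> space lebesgue \<in> sets lebesgue"
  proof (rule completion.in_sets_AE)
    show "F -` A \<inter> space lebesgue \<in> sets lebesgue"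
      by (rule measurable_sets[OF F A])
    show "AE x in lebesgue. x \<in> F -` A \<inter> space lebesgue \<longleftrightarrow> x \<in> G -` A \<inter> space lebesgue"
      using eq by eventually_elim simp
  qed simp
qed simp

text \<open>The \<open>L\<^sup>\<infinity>\<close> norm of \<open>f(x) w(x)\<close>, possibly infinite.\<close>

lift_definition l2_weighted_esssup :: "(real \<Rightarrow> real) \<Rightarrow> l2 \<Rightarrow> ereal"
  is "\<lambda>w f. esssup lebesgue (\<lambda>x. ereal (cmod (f x * complex_of_real (w x))))"
proof -
  fix w and f g :: "real \<Rightarrow> complex"
  assume "l2_rel f g"
  then have ae: "AE x in lborel. f x = g x"
    by (simp add: l2_rel_def)
  let ?F = "\<lambda>x. ereal (cmod (f x * complex_of_real (w x)))"
  let ?G = "\<lambda>x. ereal (cmod (g x * complex_of_real (w x)))"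
  have eq: "AE x in lebesgue. ?F x = ?G x"
    using AE_completion[OF ae] by eventually_elim simp
  have eq': "AE x in lebesgue. ?G x = ?F x"
    using eq by eventually_elim (rule sym)
  have "?F \<in> borel_measurable lebesgue \<longleftrightarrow> ?G \<in> borel_measurable lebesgue"
    by (rule iffI) (rule ae_eq_measurable_lebesgue[OF eq], assumption,
        rule ae_eq_measurable_lebesgue[OF eq'], assumption)
  moreover have "Limsup (ae_filter lebesgue) ?F = Limsup (ae_filter lebesgue) ?G"
    by (rule Limsup_eq) (use eq in simp)
  ultimately show "esssup lebesgue ?F = esssup lebesgue ?G"
    by (simp add: esssup_def)
qed


section \<open>Hermite functions\<close>

definition hermite_poly :: "nat \<Rightarrow> real \<Rightarrow> real" where
  "hermite_poly m x = (-1) ^ m * exp (x\<^sup>2) * (deriv ^^ m) (\<lambda>t. exp (- t\<^sup>2)) x"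

definition hermite_fun :: "nat \<Rightarrow> real \<Rightarrow> real" where
  "hermite_fun m x = hermite_poly m x * exp (- x\<^sup>2 / 2) / sqrt (2 ^ m * fact m * sqrt pi)"

lemma higher_deriv_gaussian:
  "\<exists>p. (deriv ^^ m) (\<lambda>t. exp (- t\<^sup>2)) = (\<lambda>t::real. poly p t * exp (- t\<^sup>2))"
proof (induction m)
  case 0
  show ?case by (rule exI[of _ 1]) simp
next
  case (Suc m)
  then obtain p where p: "(deriv ^^ m) (\<lambda>t. exp (- t\<^sup>2)) = (\<lambda>t::real. poly p t * exp (- t\<^sup>2))"
    by blast
  have "deriv (\<lambda>t::real. poly p t * exp (- t\<^sup>2)) t = poly (pderiv p - [:0, 2:] * p) t * exp (- t\<^sup>2)" for t
  proof (rule DERIV_imp_deriv)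
    have "((\<lambda>t::real. exp (- t\<^sup>2)) has_real_derivative exp (- t\<^sup>2) * (- (2 * t))) (at t)"
      by (rule derivative_eq_intros refl | simp)+
    from DERIV_mult[OF poly_DERIV this, of p]
    show "((\<lambda>t::real. poly p t * exp (- t\<^sup>2)) has_real_derivative
        poly (pderiv p - [:0, 2:] * p) t * exp (- t\<^sup>2)) (at t)"
      by (rule DERIV_cong) (simp add: algebra_simps)
  qed
  then show ?case
    by (intro exI[of _ "pderiv p - [:0, 2:] * p"]) (simp add: p fun_eq_iff)
qed

lemma hermite_fun_eq: "\<exists>p. hermite_fun m = (\<lambda>x. poly p x * exp (- x\<^sup>2 / 2))"
proof -
  obtain p where p: "(deriv ^^ m) (\<lambda>t. exp (- t\<^sup>2)) = (\<lambda>t::real. poly p t * exp (- t\<^sup>2))"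
    using higher_deriv_gaussian by blast
  have "hermite_fun m x =
      poly (smult ((-1) ^ m / sqrt (2 ^ m * fact m * sqrt pi)) p) x * exp (- x\<^sup>2 / 2)" for x
  proof -
    have "exp (x\<^sup>2) * exp (- x\<^sup>2) = 1"
      by (simp flip: exp_add)
    then show ?thesis
      unfolding hermite_fun_def hermite_poly_def p by (simp add: mult.left_commute)
  qed
  then show ?thesis by blast
qed

lemma integrable_poly_gaussian:
  "integrable lborel (\<lambda>x::real. poly p x * exp (- x\<^sup>2))"
proof -
  have "integrable lborel (\<lambda>x::real. x ^ k * exp (- x\<^sup>2))" for k
  proof -
    have "integrable lborel (\<lambda>x. normal_density 0 (1 / sqrt 2) x * (x - 0) ^ k)"
      by (rule integrable_normal_moment) simp
    then have "integrable lborel (\<lambda>x. sqrt pi * (normal_density 0 (1 / sqrt 2) x * x ^ k))"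
      by simp
    moreover have "sqrt pi * (normal_density 0 (1 / sqrt 2) x * x ^ k) = x ^ k * exp (- x\<^sup>2)" for x
    proof -
      have "normal_density 0 (1 / sqrt 2) x = exp (- x\<^sup>2) / sqrt pi"
        by (simp add: normal_density_def power_divide)
      then show ?thesis by simp
    qed
    ultimately show ?thesis by (simp only:)
  qed
  then have "integrable lborel (\<lambda>x::real. \<Sum>i\<le>degree p. coeff p i * (x ^ i * exp (- x\<^sup>2)))"
    by (intro Bochner_Integration.integrable_sum integrable_mult_right)
  moreover have "(\<Sum>i\<le>degree p. coeff p i * (x ^ i * exp (- x\<^sup>2))) = poly p x * exp (- x\<^sup>2)" for x
    by (simp only: poly_altdef sum_distrib_right mult.assoc)
  ultimately show ?thesis by (simp only:)
qed

lemma square_integrable_hermite: "square_integrable (\<lambda>x. complex_of_real (hermite_fun m x))"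
proof -
  obtain p where p: "hermite_fun m = (\<lambda>x. poly p x * exp (- x\<^sup>2 / 2))"
    using hermite_fun_eq by blast
  have "(cmod (complex_of_real (hermite_fun m x)))\<^sup>2 = poly (p * p) x * exp (- x\<^sup>2)" for x
  proof -
    have "exp (- x\<^sup>2 / 2) * exp (- x\<^sup>2 / 2) = exp (- x\<^sup>2)"
      by (simp flip: exp_add)
    then show ?thesis
      unfolding norm_of_real power2_abs p by (simp add: power2_eq_square algebra_simps)
  qed
  moreover have "(\<lambda>x. complex_of_real (hermite_fun m x)) \<in> borel_measurable lborel"
  proof -
    have "(\<lambda>x. complex_of_real (hermite_fun m x)) \<in> borel_measurable borel"
      unfolding p by (intro borel_measurable_continuous_onI continuous_intros) auto
    then show ?thesis by simp
  qed
  ultimately show ?thesis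
    using integrable_poly_gaussian[of "p * p"]
    by (simp only: square_integrable_def)
qed

lift_definition hermite_l2 :: "nat \<Rightarrow> l2" is "\<lambda>m x. complex_of_real (hermite_fun m x)"
  by (simp add: l2_rel_def square_integrable_hermite)

definition hermite_coeffs :: "l2 \<Rightarrow> nat \<Rightarrow> complex" where
  "hermite_coeffs f = (\<lambda>n. l2_inner f (hermite_l2 n))"


section \<open>The function and sequence spaces\<close>

text \<open>\<open>S_step \<omega> l\<close> and \<open>S_norm \<omega> l\<close> are the space \<open>\<S>\<^bsub>l\<omega>\<^esub>\<close> and its norm; similarly for
  \<open>\<Lambda>\<^bsub>l\<omega>\<^esub>\<close>. The \<open>O\<close>-conditions are uniform on the whole line, so that they say exactly that the
  norms are finite. The transform is a continuous function, so its \<open>L\<^sup>\<infinity>\<close> norm is a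
  supremum.\<close>

definition S_step :: "(real \<Rightarrow> real) \<Rightarrow> real \<Rightarrow> l2 set" where
  "S_step \<omega> l = {f. l2_ae_bounded (\<lambda>x. exp (- l * \<omega> \<bar>x\<bar>)) f \<and>
     (\<exists>C. \<forall>\<xi>. cmod (l2_fourier f \<xi>) \<le> C * exp (- l * \<omega> \<bar>\<xi>\<bar>))}"

definition S_norm :: "(real \<Rightarrow> real) \<Rightarrow> real \<Rightarrow> l2 \<Rightarrow> real" where
  "S_norm \<omega> l f = real_of_ereal (l2_weighted_esssup (\<lambda>x. exp (l * \<omega> \<bar>x\<bar>)) f) +
     (SUP \<xi>. cmod (l2_fourier f \<xi>) * exp (l * \<omega> \<bar>\<xi>\<bar>))"

definition S_inductive :: "(real \<Rightarrow> real) \<Rightarrow> l2 set" where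
  "S_inductive \<omega> = (\<Union>\<epsilon>\<in>{0<..}. S_step \<omega> \<epsilon>)"

definition S_projective :: "(real \<Rightarrow> real) \<Rightarrow> l2 set" where
  "S_projective \<omega> = (\<Inter>N\<in>{0<..}. S_step \<omega> N)"

definition Lambda_step :: "(real \<Rightarrow> real) \<Rightarrow> real \<Rightarrow> (nat \<Rightarrow> complex) set" where
  "Lambda_step \<omega> l = {\<alpha>. \<exists>C. \<forall>n. cmod (\<alpha> n) \<le> C * exp (- l * \<omega> (sqrt (real n)))}"

definition Lambda_norm :: "(real \<Rightarrow> real) \<Rightarrow> real \<Rightarrow> (nat \<Rightarrow> complex) \<Rightarrow> real" where
  "Lambda_norm \<omega> l \<alpha> = (SUP n. cmod (\<alpha> n) * exp (l * \<omega> (sqrt (real n))))"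

definition Lambda_inductive :: "(real \<Rightarrow> real) \<Rightarrow> (nat \<Rightarrow> complex) set" where
  "Lambda_inductive \<omega> = (\<Union>\<epsilon>\<in>{0<..}. Lambda_step \<omega> \<epsilon>)"

definition Lambda_projective :: "(real \<Rightarrow> real) \<Rightarrow> (nat \<Rightarrow> complex) set" where
  "Lambda_projective \<omega> = (\<Inter>N\<in>{0<..}. Lambda_step \<omega> N)"

text \<open>The spaces are the unions and intersections of the families whose norms enter the
  definition of tameness.\<close>

lemma exp_weight_mono:
  fixes C y :: real
  assumes "y \<le> C * exp (- l * a)" "k \<le> l" "0 \<le> a"
  shows "y \<le> \<bar>C\<bar> * exp (- k * a)"
proof -
  have "y \<le> \<bar>C\<bar> * exp (- l * a)"
    using assms(1) by (rule order_trans) (simp add: mult_right_mono)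
  also have "\<dots> \<le> \<bar>C\<bar> * exp (- k * a)"
    using assms by (intro mult_left_mono) (auto simp: mult_right_mono)
  finally show ?thesis .
qed

lemma l2_ae_bounded_antimono:
  assumes "l2_ae_bounded (\<lambda>x. exp (- l * \<omega> \<bar>x\<bar>)) f" "k \<le> l" "\<forall>t\<ge>0. 0 \<le> \<omega> t"
  shows "l2_ae_bounded (\<lambda>x. exp (- k * \<omega> \<bar>x\<bar>)) f"
  using assms
proof transfer
  fix l k :: real and \<omega> :: "real \<Rightarrow> real" and f :: "real \<Rightarrow> complex"
  assume "\<exists>C. AE x in lborel. cmod (f x) \<le> C * exp (- l * \<omega> \<bar>x\<bar>)" and k: "k \<le> l"
    and pos: "\<forall>t\<ge>0. 0 \<le> \<omega> t"
  then obtain C where "AE x in lborel. cmod (f x) \<le> C * exp (- l * \<omega> \<bar>x\<bar>)"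
    by blast
  then have "AE x in lborel. cmod (f x) \<le> \<bar>C\<bar> * exp (- k * \<omega> \<bar>x\<bar>)"
    by eventually_elim (rule exp_weight_mono, assumption, rule k, simp add: pos)
  then show "\<exists>C. AE x in lborel. cmod (f x) \<le> C * exp (- k * \<omega> \<bar>x\<bar>)"
    by blast
qed

lemma S_step_antimono:
  assumes "weight_function \<omega>" "k \<le> l"
  shows "S_step \<omega> l \<subseteq> S_step \<omega> k"
proof
  have pos: "\<forall>t\<ge>0. 0 \<le> \<omega> t"
    using assms(1) by (simp add: weight_function_def)
  fix f assume f: "f \<in> S_step \<omega> l"
  then obtain C where C: "\<And>\<xi>. cmod (l2_fourier f \<xi>) \<le> C * exp (- l * \<omega> \<bar>\<xi>\<bar>)"
    unfolding S_step_def by blast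
  have "cmod (l2_fourier f \<xi>) \<le> \<bar>C\<bar> * exp (- k * \<omega> \<bar>\<xi>\<bar>)" for \<xi>
    by (rule exp_weight_mono[OF C assms(2)]) (simp add: pos)
  moreover have "l2_ae_bounded (\<lambda>x. exp (- k * \<omega> \<bar>x\<bar>)) f"
    using f assms(2) pos l2_ae_bounded_antimono[of l \<omega> f k] by (simp add: S_step_def)
  ultimately show "f \<in> S_step \<omega> k"
    unfolding S_step_def by blast
qed

lemma Lambda_step_antimono:
  assumes "weight_function \<omega>" "k \<le> l"
  shows "Lambda_step \<omega> l \<subseteq> Lambda_step \<omega> k"
proof
  have pos: "\<forall>t\<ge>0. 0 \<le> \<omega> t"
    using assms(1) by (simp add: weight_function_def)
  fix \<alpha> assume "\<alpha> \<in> Lambda_step \<omega> l"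
  then obtain C where C: "\<And>n. cmod (\<alpha> n) \<le> C * exp (- l * \<omega> (sqrt (real n)))"
    unfolding Lambda_step_def by blast
  have "cmod (\<alpha> n) \<le> \<bar>C\<bar> * exp (- k * \<omega> (sqrt (real n)))" for n
    by (rule exp_weight_mono[OF C assms(2)]) (simp add: pos)
  then show "\<alpha> \<in> Lambda_step \<omega> k"
    unfolding Lambda_step_def by blast
qed

lemma UN_steps_eq:
  fixes X :: "real \<Rightarrow> 'a set"
  assumes "\<And>k l. k \<le> l \<Longrightarrow> X l \<subseteq> X k"
  shows "(\<Union>\<epsilon>\<in>{0<..}. X \<epsilon>) = (\<Union>j\<in>{1..}. X (1 / real j))"
proof (intro equalityI subsetI)
  fix x assume "x \<in> (\<Union>\<epsilon>\<in>{0<..}. X \<epsilon>)"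
  then obtain \<epsilon> where \<epsilon>: "0 < \<epsilon>" "x \<in> X \<epsilon>"
    by auto
  obtain n where "inverse (real (Suc n)) < \<epsilon>"
    using reals_Archimedean[OF \<epsilon>(1)] by auto
  then have "x \<in> X (1 / real (Suc n))"
    using assms[of "1 / real (Suc n)" \<epsilon>] \<epsilon>(2) by (auto simp: inverse_eq_divide)
  then show "x \<in> (\<Union>j\<in>{1..}. X (1 / real j))"
    by (intro UN_I[of "Suc n"]) auto
next
  fix x assume "x \<in> (\<Union>j\<in>{1..}. X (1 / real j))"
  then obtain j :: nat where "1 \<le> j" "x \<in> X (1 / real j)"
    by auto
  then show "x \<in> (\<Union>\<epsilon>\<in>{0<..}. X \<epsilon>)"
    by (intro UN_I[of "1 / real j"]) auto
qed

lemma INT_steps_eq: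
  fixes X :: "real \<Rightarrow> 'a set"
  assumes "\<And>k l. k \<le> l \<Longrightarrow> X l \<subseteq> X k"
  shows "(\<Inter>N\<in>{0<..}. X N) = (\<Inter>j\<in>{1..}. X (real j))"
proof (intro equalityI subsetI)
  fix x assume x: "x \<in> (\<Inter>j\<in>{1..}. X (real j))"
  show "x \<in> (\<Inter>N\<in>{0<..}. X N)"
  proof
    fix N :: real
    obtain n :: nat where "N < real n"
      using reals_Archimedean2 by blast
    then have "N \<le> real (Suc n)"
      by simp
    then have "X (real (Suc n)) \<subseteq> X N"
      by (rule assms)
    moreover have "x \<in> X (real (Suc n))"
      by (rule INT_D[OF x]) simp
    ultimately show "x \<in> X N"
      by blast
  qed
next
  fix x assume "x \<in> (\<Inter>N\<in>{0<..}. X N)"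
  then show "x \<in> (\<Inter>j\<in>{1..}. X (real j))"
    by auto
qed

lemma spaces_eq_steps:
  assumes "weight_function \<omega>"
  shows "S_inductive \<omega> = (\<Union>j\<in>{1..}. S_step \<omega> (1 / real j))"
    and "S_projective \<omega> = (\<Inter>j\<in>{1..}. S_step \<omega> (real j))"
    and "Lambda_inductive \<omega> = (\<Union>j\<in>{1..}. Lambda_step \<omega> (1 / real j))"
    and "Lambda_projective \<omega> = (\<Inter>j\<in>{1..}. Lambda_step \<omega> (real j))"
  unfolding S_inductive_def S_projective_def Lambda_inductive_def Lambda_projective_def
  by (rule UN_steps_eq INT_steps_eq, erule S_step_antimono[OF assms] Lambda_step_antimono[OF assms])+

end

theory Submission
  imports Defs "HOL-Probability.Levy" "HOL-Probability.Sinc_Integral"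
    "HOL-Complex_Analysis.Complex_Analysis"
begin

text \<open>The argument rests on the Bargmann kernel
  \<open>G(x, z) = \<pi>\<^sup>-\<^sup>1\<^sup>/\<^sup>4 exp (- z\<^sup>2/2 + \<surd>2 x z - x\<^sup>2/2) = \<Sum>n. h\<^sub>n(x) z\<^sup>n / \<surd>n!\<close>, for which
  \<open>|G(x, z)| \<le> exp (|z|\<^sup>2/2 - (\<surd>2 Re z - x)\<^sup>2/2)\<close> and whose Fourier transform in \<open>x\<close>
  is the kernel at \<open>- \<i> z\<close>.

  From functions to coefficients: \<open>F(z) = \<integral> f(x) G(x, z) dx\<close> has Taylor coefficients
  \<open>\<langle>f, h\<^sub>n\<rangle> / \<surd>n!\<close>. If \<open>|Re z|\<close> is large, the decay of \<open>f\<close> bounds \<open>F(z)\<close>; if \<open>|Im z|\<close> is large, the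
  decay of the transform of \<open>f\<close> does. Cauchy's estimate on the circle of radius \<open>\<surd>n\<close> then gives the
  decay of \<open>\<langle>f, h\<^sub>n\<rangle>\<close> up to a factor of order \<open>\<surd>n\<close>, which is harmless because
  \<open>log t = o(\<omega>(t))\<close>.

  From coefficients to functions: Cauchy's estimate for \<open>G(x, \<cdot>)\<close> shows that \<open>h\<^sub>n(x)\<close> is at most of order
  \<open>\<surd>n\<close>, with a further factor \<open>exp (- x\<^sup>2/8)\<close> when \<open>8 n \<le> x\<^sup>2\<close>; summing \<open>\<Sum>n. \<alpha>\<^sub>n h\<^sub>n\<close> and
  \<open>\<Sum>n. (- \<i>)\<^sup>n \<alpha>\<^sub>n h\<^sub>n\<close>, its transform, gives the decay of both.

  Gaussian errors are absorbed by \<open>\<lambda>\<omega>(t) \<le> t\<^sup>2 + O(1)\<close>, and dilations of the argument of \<open>\<omega>\<close> cost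
  only a constant factor by \<open>\<omega>(2t) = O(\<omega>(t))\<close>, independent of \<open>\<lambda>\<close>.\<close>

section \<open>The Bargmann kernel\<close>

lemma power_series_deriv_at_zero:
  fixes F :: "complex \<Rightarrow> complex"
  assumes "\<And>z. (\<lambda>n. a n * z ^ n) sums F z"
  shows "(deriv ^^ n) F 0 = fact n * a n"
proof -
  have "F has_fps_expansion Abs_fps a"
    by (rule has_fps_expansionI) (use assms in simp)
  then show ?thesis
    using fps_nth_fps_expansion[of F "Abs_fps a" n] by (simp add: field_simps)
qed

lemma power_series_entire:
  fixes F :: "complex \<Rightarrow> complex"
  assumes "\<And>z. (\<lambda>n. a n * z ^ n) sums F z"
  shows "F holomorphic_on ball 0 r"
  using power_series_holomorphic[of 0 r a F] assms by simp

text \<open>Cauchy's estimate, written as a product so that \<open>r = 0\<close> is allowed. The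
  radius used later is \<open>sqrt (real n)\<close>, which vanishes at \<open>n = 0\<close>; there
  \<open>0 ^ 0 = 1\<close> and the bound on \<open>F 0\<close> is needed.\<close>

lemma power_series_coeff_bound:
  fixes F :: "complex \<Rightarrow> complex"
  assumes F: "\<And>z. (\<lambda>n. a n * z ^ n) sums F z"
    and B: "\<And>z. cmod z = r \<Longrightarrow> cmod (F z) \<le> B" and r: "0 \<le> r"
  shows "cmod (a n) * r ^ n \<le> B"
proof (cases "r = 0")
  case True
  have "(\<lambda>n. a n * 0 ^ n) sums a 0"
    by (rule powser_sums_zero)
  then have "F 0 = a 0"
    using F[of 0] by (rule sums_unique2[symmetric])
  moreover have "cmod (F 0) \<le> B"
    using B[of 0] True by simp
  moreover from this have "0 \<le> B"
    by (rule order_trans[OF norm_ge_zero])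
  ultimately show ?thesis
    using True by (cases n) auto
next
  case False
  \<comment> \<open>The larger ball gives continuity up to the boundary of the closed disc.\<close>
  have hol: "F holomorphic_on ball 0 (r + 1)"
    by (rule power_series_entire[OF F])
  have "cmod ((deriv ^^ n) F 0) \<le> fact n * B / r ^ n"
  proof (rule Cauchy_inequality)
    show "F holomorphic_on ball 0 r"
      by (rule power_series_entire[OF F])
    show "continuous_on (cball 0 r) F"
      using hol by (rule holomorphic_on_imp_continuous_on[THEN continuous_on_subset]) auto
  qed (use False r B in auto)
  then have "fact n * cmod (a n) \<le> fact n * (B / r ^ n)"
    by (simp add: power_series_deriv_at_zero[OF F] norm_mult)
  then have "cmod (a n) \<le> B / r ^ n"
    by (subst (asm) mult_le_cancel_left_pos) auto
  then show ?thesis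
    using False r by (simp add: pos_le_divide_eq)
qed

text \<open>Two expansions of one entire function are compared. Orthonormality and the transforms of
  the Hermite functions are obtained in this way from identities for the kernel.\<close>

lemma power_series_coeff_unique:
  fixes F :: "complex \<Rightarrow> complex"
  assumes "\<And>z. (\<lambda>n. a n * z ^ n) sums F z" "\<And>z. (\<lambda>n. b n * z ^ n) sums F z"
  shows "a n = b n"
  using power_series_deriv_at_zero[of a F n] power_series_deriv_at_zero[of b F n] assms by simp

text \<open>Along the real axis the imaginary part of the complex derivative differentiates the zero
  function. This lets the real derivatives in the Rodrigues formula serve as complex Taylor
  coefficients.\<close>

lemma deriv_complex_of_real:
  fixes g :: "complex \<Rightarrow> complex" and f :: "real \<Rightarrow> real"
  assumes "g holomorphic_on UNIV" and fg: "\<And>x. g (of_real x) = of_real (f x)"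
  shows "deriv g (of_real x) = of_real (deriv f x)"
proof -
  have "(g has_field_derivative deriv g (of_real x)) (at (of_real x))"
    using assms(1) by (intro holomorphic_derivI[of _ UNIV]) auto
  then have "((\<lambda>x. g (of_real x)) has_vector_derivative deriv g (of_real x)) (at x)"
    by (rule has_vector_derivative_real_field)
  then have 1: "(f has_field_derivative Re (deriv g (of_real x))) (at x)"
    and 2: "((\<lambda>x. 0::real) has_field_derivative Im (deriv g (of_real x))) (at x)"
    by (auto simp: has_vector_derivative_complex_iff fg)
  have "Im (deriv g (of_real x)) = 0"
    using 2 by (rule DERIV_unique) auto
  then show ?thesis
    using DERIV_imp_deriv[OF 1] by (simp add: complex_eq_iff)
qed

lemma higher_deriv_complex_of_real:
  fixes g :: "complex \<Rightarrow> complex" and f :: "real \<Rightarrow> real"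
  assumes g: "g holomorphic_on UNIV" and fg: "\<And>x. g (of_real x) = of_real (f x)"
  shows "(deriv ^^ n) g (of_real x) = of_real ((deriv ^^ n) f x)"
proof (induction n arbitrary: x)
  case 0
  then show ?case by (simp add: fg)
next
  case (Suc n)
  show ?case
    using deriv_complex_of_real[OF holomorphic_higher_deriv[OF g open_UNIV, of n] Suc.IH]
    by simp
qed

section \<open>The generating function of the Hermite functions and its Gaussian integrals\<close>

definition hermite_kernel :: "real \<Rightarrow> complex \<Rightarrow> complex" where
  "hermite_kernel x z =
     exp (- z\<^sup>2 / 2 + of_real (sqrt 2 * x) * z - of_real (x\<^sup>2 / 2)) / of_real (sqrt (sqrt pi))"

text \<open>The Taylor series of \<open>exp (- w^2)\<close> about \<open>x\<close>, taken at
  \<open>w = x - z / sqrt 2\<close> and multiplied by \<open>exp (x^2 / 2) / sqrt (sqrt pi)\<close>;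
  the Rodrigues formula identifies its coefficients.\<close>

lemma hermite_kernel_sums:
  "(\<lambda>n. of_real (hermite_fun n x / sqrt (fact n)) * z ^ n) sums hermite_kernel x z"
proof -
  define g :: "complex \<Rightarrow> complex" where "g = (\<lambda>w. exp (- w\<^sup>2))"
  define D where "D n = (deriv ^^ n) (\<lambda>t::real. exp (- t\<^sup>2)) x" for n
  define c where "c = exp (x\<^sup>2 / 2) / sqrt (sqrt pi)"
  have hol: "g holomorphic_on S" for S
    unfolding g_def by (intro holomorphic_intros)
  have D: "(deriv ^^ n) g (of_real x) = of_real (D n)" for n
    unfolding D_def by (rule higher_deriv_complex_of_real[OF hol]) (simp add: g_def flip: exp_of_real)
  define w where "w = of_real x - z / of_real (sqrt 2)"
  have "(\<lambda>n. (deriv ^^ n) g (of_real x) / fact n * (w - of_real x) ^ n) sums g w"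
    by (rule holomorphic_power_series[where r = "dist (of_real x) w + 1"]) (auto intro: hol)
  then have "(\<lambda>n. of_real c * ((deriv ^^ n) g (of_real x) / fact n * (w - of_real x) ^ n)) sums
      (of_real c * g w)"
    by (rule sums_mult)
  moreover have "of_real c * ((deriv ^^ n) g (of_real x) / fact n * (w - of_real x) ^ n) =
      of_real (hermite_fun n x / sqrt (fact n)) * z ^ n" for n
  proof -
    have "exp (x\<^sup>2) * exp (- x\<^sup>2 / 2) = exp (x\<^sup>2 / 2)"
      by (simp flip: exp_add)
    then have h: "hermite_fun n x =
        (-1) ^ n * D n * exp (x\<^sup>2 / 2) / (sqrt (2 ^ n) * sqrt (fact n) * sqrt (sqrt pi))"
      unfolding hermite_fun_def hermite_poly_def D_def
      by (simp add: real_sqrt_mult mult.assoc mult.left_commute)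
    have "hermite_fun n x / sqrt (fact n) =
        c * (D n / fact n) * (- 1 / sqrt 2) ^ n"
    proof -
      have "inverse (fact n :: real) = inverse (sqrt (fact n)) * inverse (sqrt (fact n))"
        by (simp flip: inverse_mult_distrib)
      moreover have "(- 1 / sqrt 2) ^ n = (-1) ^ n / sqrt (2 ^ n)"
        unfolding power_divide real_sqrt_power by simp
      ultimately show ?thesis
        unfolding h c_def by (simp only: divide_inverse inverse_mult_distrib mult_ac)
    qed
    moreover have "(w - of_real x) ^ n = of_real ((- 1 / sqrt 2) ^ n) * z ^ n"
      by (simp add: w_def flip: power_mult_distrib)
    ultimately show ?thesis
      unfolding D by simp
  qed
  moreover have "of_real c * g w = hermite_kernel x z"
  proof -
    have "complex_of_real (sqrt 2) * of_real (sqrt 2) = 2"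
      by (simp flip: of_real_mult)
    then have "of_real (x\<^sup>2 / 2) + (- w\<^sup>2) =
        - z\<^sup>2 / 2 + of_real (sqrt 2 * x) * z - of_real (x\<^sup>2 / 2)"
      unfolding w_def by (simp add: power2_eq_square field_simps)
    then have "exp (complex_of_real (x\<^sup>2 / 2)) * exp (- w\<^sup>2) =
        exp (- z\<^sup>2 / 2 + of_real (sqrt 2 * x) * z - of_real (x\<^sup>2 / 2))"
      by (metis exp_add)
    then show ?thesis
      unfolding c_def g_def hermite_kernel_def by (simp flip: exp_of_real)
  qed
  ultimately show ?thesis
    by simp
qed

text \<open>Completing the square in \<open>Re z\<close>. As a function of \<open>x\<close> the
  modulus is a Gaussian centred at \<open>sqrt 2 * Re z\<close>, and the decay estimates below
  exploit the distance of \<open>x\<close> from this centre.\<close>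

lemma norm_hermite_kernel:
  "cmod (hermite_kernel x z) = exp ((cmod z)\<^sup>2 / 2 - (sqrt 2 * Re z - x)\<^sup>2 / 2) / sqrt (sqrt pi)"
proof -
  have "Re (- z\<^sup>2 / 2 + of_real (sqrt 2 * x) * z - of_real (x\<^sup>2 / 2)) =
      (cmod z)\<^sup>2 / 2 - (sqrt 2 * Re z - x)\<^sup>2 / 2"
    by (simp add: cmod_power2 power2_diff power_mult_distrib Re_power2) (simp add: field_simps)
  then show ?thesis
    unfolding hermite_kernel_def by (simp add: norm_divide)
qed

text \<open>The imaginary part of \<open>b\<close> is handled by the characteristic function of the
  standard normal distribution, the real part by translating the variable by
  \<open>Re b\<close>.\<close>

lemma has_bochner_integral_gaussian:
  fixes b :: complex
  shows
  "has_bochner_integral lborel (\<lambda>x. exp (- of_real (x\<^sup>2 / 2) + b * of_real x))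
     (of_real (sqrt (2 * pi)) * exp (b\<^sup>2 / 2))"
proof -
  have int: "integrable lborel (\<lambda>x. std_normal_density x *\<^sub>R iexp (t * x))" for t
    by (subst integrable_density[symmetric])
      (auto intro!: prob_space.integrable_iexp real_distribution.axioms(1) real_dist_normal_dist)
  have "(\<integral>x. std_normal_density x *\<^sub>R iexp (t * x) \<partial>lborel) = exp (- (t\<^sup>2) / 2)" for t
    using fun_cong[OF char_std_normal_distribution, of t] unfolding char_def
    by (subst (asm) integral_density) auto
  with int have *: "has_bochner_integral lborel (\<lambda>x. std_normal_density x *\<^sub>R iexp (t * x))
      (of_real (exp (- (t\<^sup>2) / 2)))" for t
    by (simp add: has_bochner_integral_iff)
  \<comment> \<open>\<open>c\<close> collects the factors split off by the translation and the
    normalisation of the density.\<close>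
  define c where "c = of_real (sqrt (2 * pi)) * exp (of_real ((Re b)\<^sup>2 / 2) + \<i> * of_real (Re b * Im b))"
  have "has_bochner_integral lborel
      (\<lambda>x. c * (std_normal_density (- Re b + 1 * x) *\<^sub>R iexp (Im b * (- Re b + 1 * x))))
      (c * of_real (exp (- ((Im b)\<^sup>2) / 2)))"
    using lborel_has_bochner_integral_real_affine_iff[of 1, THEN iffD1, OF _ *[of "Im b"], of "- Re b"]
    by (intro has_bochner_integral_mult_right) auto
  moreover have "c * (std_normal_density (- Re b + 1 * x) *\<^sub>R iexp (Im b * (- Re b + 1 * x))) =
      exp (- of_real (x\<^sup>2 / 2) + b * of_real x)" for x
  proof -
    have "of_real ((Re b)\<^sup>2 / 2) + \<i> * of_real (Re b * Im b) + of_real (- (- Re b + x)\<^sup>2 / 2)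
        + \<i> * of_real (Im b * (- Re b + x)) = - of_real (x\<^sup>2 / 2) + b * of_real x"
      by (simp add: complex_eq_iff power2_eq_square field_simps)
    then have "exp (of_real ((Re b)\<^sup>2 / 2) + \<i> * of_real (Re b * Im b)) *
        exp (complex_of_real (- (- Re b + x)\<^sup>2 / 2)) * exp (\<i> * of_real (Im b * (- Re b + x)))
        = exp (- of_real (x\<^sup>2 / 2) + b * of_real x)"
      by (metis exp_add)
    then show ?thesis
      by (simp add: c_def std_normal_density_def scaleR_conv_of_real mult.assoc flip: exp_of_real)
  qed
  moreover have "c * of_real (exp (- ((Im b)\<^sup>2) / 2)) = of_real (sqrt (2 * pi)) * exp (b\<^sup>2 / 2)"
  proof -
    have "of_real ((Re b)\<^sup>2 / 2) + \<i> * of_real (Re b * Im b) + of_real (- ((Im b)\<^sup>2) / 2) = b\<^sup>2 / 2"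
      by (simp add: complex_eq_iff power2_eq_square field_simps)
    then have "exp (of_real ((Re b)\<^sup>2 / 2) + \<i> * of_real (Re b * Im b)) *
        exp (complex_of_real (- ((Im b)\<^sup>2) / 2)) = exp (b\<^sup>2 / 2)"
      by (metis exp_add)
    then show ?thesis
      by (simp add: c_def flip: exp_of_real)
  qed
  ultimately show ?thesis
    by simp
qed

text \<open>The integrand is a Gaussian with linear coefficient \<open>b\<close>. Its square turns
  \<open>- w^2 / 2\<close> into \<open>w^2 / 2\<close>, which is the quadratic term of the kernel at
  \<open>- i w\<close>.\<close>

lemma fourier_hermite_kernel:
  "has_bochner_integral lborel
     (\<lambda>y. hermite_kernel y w * exp (- \<i> * of_real (x * y)))
     (of_real (sqrt (2 * pi)) * hermite_kernel x (- \<i> * w))"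
proof -
  define b where "b = of_real (sqrt 2) * w - \<i> * of_real x"
  define c where "c = exp (- w\<^sup>2 / 2) / of_real (sqrt (sqrt pi))"
  have "has_bochner_integral lborel (\<lambda>y. c * exp (- of_real (y\<^sup>2 / 2) + b * of_real y))
      (c * (of_real (sqrt (2 * pi)) * exp (b\<^sup>2 / 2)))"
    by (intro has_bochner_integral_mult_right has_bochner_integral_gaussian)
  moreover have "c * exp (- of_real (y\<^sup>2 / 2) + b * of_real y) =
      hermite_kernel y w * exp (- \<i> * of_real (x * y))" for y
    by (simp add: c_def b_def hermite_kernel_def algebra_simps flip: exp_add)
  moreover have "c * (of_real (sqrt (2 * pi)) * exp (b\<^sup>2 / 2)) =
      of_real (sqrt (2 * pi)) * hermite_kernel x (- \<i> * w)"
  proof -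
    have "complex_of_real (sqrt 2) * of_real (sqrt 2) = 2"
      by (simp flip: of_real_mult)
    then have "- w\<^sup>2 / 2 + b\<^sup>2 / 2 =
       - (- \<i> * w)\<^sup>2 / 2 + of_real (sqrt 2 * x) * (- \<i> * w) - of_real (x\<^sup>2 / 2)"
      unfolding b_def by (simp add: power2_eq_square field_simps)
    then have "exp (- w\<^sup>2 / 2) * exp (b\<^sup>2 / 2) =
       exp (- (- \<i> * w)\<^sup>2 / 2 + of_real (sqrt 2 * x) * (- \<i> * w) - of_real (x\<^sup>2 / 2))"
      by (metis exp_add)
    then show ?thesis
      by (simp add: c_def hermite_kernel_def)
  qed
  ultimately show ?thesis
    by simp
qed

text \<open>The product carries the factor \<open>exp (- x^2)\<close>, so the variable is scaled by
  \<open>sqrt 2\<close> before the Gaussian integral applies. That the value depends on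
  \<open>z * w\<close> only is the generating form of orthonormality.\<close>

lemma hermite_kernel_product_integral:
  "has_bochner_integral lborel (\<lambda>x. hermite_kernel x z * hermite_kernel x w) (exp (z * w))"
proof -
  define c where "c = exp (- (z\<^sup>2 + w\<^sup>2) / 2) / of_real (sqrt pi)"
  have "has_bochner_integral lborel
      (\<lambda>x. exp (- of_real ((0 + sqrt 2 * x)\<^sup>2 / 2) + (z + w) * of_real (0 + sqrt 2 * x)))
      ((of_real (sqrt (2 * pi)) * exp ((z + w)\<^sup>2 / 2)) /\<^sub>R \<bar>sqrt 2\<bar>)"
    using has_bochner_integral_gaussian[of "z + w"]
    by (subst (asm) lborel_has_bochner_integral_real_affine_iff[where c = "sqrt 2" and t = 0]) auto
  then have "has_bochner_integral lborel
      (\<lambda>x. c * exp (- of_real ((0 + sqrt 2 * x)\<^sup>2 / 2) + (z + w) * of_real (0 + sqrt 2 * x)))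
      (c * ((of_real (sqrt (2 * pi)) * exp ((z + w)\<^sup>2 / 2)) /\<^sub>R \<bar>sqrt 2\<bar>))"
    by (intro has_bochner_integral_mult_right) auto
  moreover have "c * exp (- of_real ((0 + sqrt 2 * x)\<^sup>2 / 2) + (z + w) * of_real (0 + sqrt 2 * x)) =
      hermite_kernel x z * hermite_kernel x w" for x
  proof -
    have "- (z\<^sup>2 + w\<^sup>2) / 2 + (- of_real ((0 + sqrt 2 * x)\<^sup>2 / 2) + (z + w) * of_real (0 + sqrt 2 * x)) =
      (- z\<^sup>2 / 2 + of_real (sqrt 2 * x) * z - of_real (x\<^sup>2 / 2)) +
      (- w\<^sup>2 / 2 + of_real (sqrt 2 * x) * w - of_real (x\<^sup>2 / 2))"
      by (simp add: power_mult_distrib field_simps)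
    then have "exp (- (z\<^sup>2 + w\<^sup>2) / 2) *
        exp (- of_real ((0 + sqrt 2 * x)\<^sup>2 / 2) + (z + w) * of_real (0 + sqrt 2 * x)) =
        exp (- z\<^sup>2 / 2 + of_real (sqrt 2 * x) * z - of_real (x\<^sup>2 / 2)) *
        exp (- w\<^sup>2 / 2 + of_real (sqrt 2 * x) * w - of_real (x\<^sup>2 / 2))"
      by (metis exp_add)
    moreover have "complex_of_real (sqrt (sqrt pi)) * of_real (sqrt (sqrt pi)) = of_real (sqrt pi)"
      by (simp flip: of_real_mult)
    ultimately show ?thesis
      by (simp add: c_def hermite_kernel_def)
  qed
  moreover have "c * ((of_real (sqrt (2 * pi)) * exp ((z + w)\<^sup>2 / 2)) /\<^sub>R \<bar>sqrt 2\<bar>) = exp (z * w)"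
  proof -
    have "- (z\<^sup>2 + w\<^sup>2) / 2 + (z + w)\<^sup>2 / 2 = z * w"
      by (simp add: power2_eq_square field_simps)
    then have "exp (- (z\<^sup>2 + w\<^sup>2) / 2) * exp ((z + w)\<^sup>2 / 2) = exp (z * w)"
      by (metis exp_add)
    then show ?thesis
      by (simp add: c_def real_sqrt_mult scaleR_conv_of_real field_simps)
  qed
  ultimately show ?thesis
    by simp
qed

section \<open>Hermite functions\<close>

lemma hermite_fun_measurable [measurable]: "hermite_fun n \<in> borel_measurable borel"
proof -
  obtain p where "hermite_fun n = (\<lambda>x. poly p x * exp (- x\<^sup>2 / 2))"
    using hermite_fun_eq by blast
  then show ?thesis
    by (simp add: borel_measurable_continuous_onI continuous_intros)
qed

lemma hermite_kernel_measurable [measurable]: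
  "(\<lambda>x. hermite_kernel x z) \<in> borel_measurable borel"
  unfolding hermite_kernel_def
  by (intro borel_measurable_continuous_onI continuous_intros) auto

text \<open>Cauchy's estimate for the kernel on the circle of radius \<open>r\<close>, where
  \<open>Re z\<close> is at most \<open>r\<close> in modulus. The free parameter \<open>c\<close>
  bounds the Gaussian exponent from below there; the three applications take \<open>0\<close>,
  \<open>x^2 / 8\<close> and \<open>x^2 / 4 - (2 r)^2\<close>.\<close>

lemma hermite_coeff_bound:
  assumes r: "0 \<le> r" and c: "\<And>u. \<bar>u\<bar> \<le> r \<Longrightarrow> c \<le> (sqrt 2 * u - x)\<^sup>2 / 2"
  shows "\<bar>hermite_fun n x\<bar> / sqrt (fact n) * r ^ n \<le> exp (r\<^sup>2 / 2 - c)"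
proof -
  have "cmod (hermite_kernel x z) \<le> exp (r\<^sup>2 / 2 - c)" if "cmod z = r" for z
  proof -
    have "\<bar>Re z\<bar> \<le> r"
      using abs_Re_le_cmod that by blast
    then have "exp ((cmod z)\<^sup>2 / 2 - (sqrt 2 * Re z - x)\<^sup>2 / 2) \<le> exp (r\<^sup>2 / 2 - c)"
      using c that by simp
    moreover have "1 \<le> sqrt (sqrt pi)"
      using pi_ge_two by simp
    ultimately have "exp ((cmod z)\<^sup>2 / 2 - (sqrt 2 * Re z - x)\<^sup>2 / 2) / sqrt (sqrt pi) \<le> exp (r\<^sup>2 / 2 - c) / 1"
      by (intro frac_le) auto
    then show ?thesis
      by (simp add: norm_hermite_kernel)
  qed
  from power_series_coeff_bound[OF hermite_kernel_sums this r, of n]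
  show ?thesis
    by (simp add: norm_divide)
qed

text \<open>A weak form of Stirling's formula, by induction from \<open>n = 1\<close> with the
  factor \<open>real n\<close>. The factor \<open>real n + 1\<close> covers \<open>n = 0\<close>
  too, where \<open>0 ^ 0 = 1\<close>.\<close>

lemma fact_exp_le: "fact n * exp (real n) \<le> exp 1 * (real n + 1) * real n ^ n"
proof (cases "n = 0")
  case False
  then have "0 < n"
    by simp
  then have "fact n * exp (real n) \<le> exp 1 * real n * real n ^ n"
  proof (induction n rule: nat_induct_non_zero)
    case (Suc n)
    define m where "m = real n"
    have m: "1 \<le> m"
      using Suc by (simp add: m_def)
    have "m / (m + 1) = 1 + - (1 / (m + 1))"
      using m by (simp add: field_simps)
    also have "\<dots> \<le> exp (- (1 / (m + 1)))"
      by (rule exp_ge_add_one_self)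
    finally have "exp (1 / (m + 1)) * m \<le> m + 1"
      using m by (simp add: exp_minus field_simps)
    then have "(exp (1 / (m + 1)) * m) ^ Suc n \<le> (m + 1) ^ Suc n"
      using m by (intro power_mono) auto
    moreover have "exp (1 / (m + 1)) ^ Suc n = exp 1"
      unfolding exp_of_nat_mult[symmetric] by (simp add: m_def field_simps)
    \<comment> \<open>Equivalent to \<open>exp 1 <= (1 + 1 / m) ^ Suc n\<close>; its source is
      \<open>1 + y <= exp y\<close> at \<open>y = - 1 / (m + 1)\<close>.\<close>
    ultimately have step: "exp 1 * m ^ Suc n \<le> (m + 1) ^ Suc n"
      unfolding power_mult_distrib by simp
    have "fact (Suc n) * exp (real (Suc n)) = (m + 1) * exp 1 * (fact n * exp m)"
      by (simp add: m_def exp_add algebra_simps)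
    also have "\<dots> \<le> (m + 1) * exp 1 * (exp 1 * m * m ^ n)"
      using Suc.IH m by (intro mult_left_mono) (auto simp: m_def)
    also have "\<dots> = exp 1 * (m + 1) * (exp 1 * m ^ Suc n)"
      by simp
    also have "\<dots> \<le> exp 1 * (m + 1) * (m + 1) ^ Suc n"
      using step m by (intro mult_left_mono) auto
    finally show ?case
      by (simp add: m_def add.commute)
  qed simp
  also have "\<dots> \<le> exp 1 * (real n + 1) * real n ^ n"
    by (intro mult_right_mono) auto
  finally show ?thesis .
qed simp

lemma sqrt_fact_exp_le:
  "sqrt (fact n) * exp (real n / 2) \<le> sqrt (exp 1 * (real n + 1)) * sqrt (real n) ^ n"
proof -
  have "sqrt (fact n * exp (real n)) \<le> sqrt (exp 1 * (real n + 1) * real n ^ n)"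
    by (intro real_sqrt_le_mono fact_exp_le)
  moreover have "sqrt (exp (real n)) = exp (real n / 2)"
    by (rule real_sqrt_unique) (auto simp flip: exp_of_nat_mult)
  ultimately show ?thesis
    by (simp add: real_sqrt_mult real_sqrt_power)
qed

text \<open>On the circle of radius \<open>sqrt (real n)\<close> the growth
  \<open>exp (real n / 2)\<close> of the kernel is offset by
  \<open>sqrt (fact n) / sqrt (real n) ^ n\<close>, up to the factor left by Stirling's
  formula.\<close>

lemma le_of_coeff_le:
  assumes "a / sqrt (fact n) * sqrt (real n) ^ n \<le> exp (real n / 2) * B" "0 \<le> B"
  shows "a \<le> sqrt (exp 1 * (real n + 1)) * B"
proof -
  have pos: "0 < sqrt (real n) ^ n"
    by (cases "n = 0") auto
  have "a * sqrt (real n) ^ n \<le> (sqrt (fact n) * exp (real n / 2)) * B"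
    using assms(1) by (simp add: field_simps)
  also have "\<dots> \<le> (sqrt (exp 1 * (real n + 1)) * sqrt (real n) ^ n) * B"
    by (intro mult_right_mono sqrt_fact_exp_le assms(2))
  finally have "a * sqrt (real n) ^ n \<le> (sqrt (exp 1 * (real n + 1)) * B) * sqrt (real n) ^ n"
    by (simp only: mult_ac)
  then show ?thesis
    using pos by simp
qed

lemma hermite_fun_le: "\<bar>hermite_fun n x\<bar> \<le> sqrt (exp 1 * (real n + 1))"
proof -
  have "\<bar>hermite_fun n x\<bar> / sqrt (fact n) * sqrt (real n) ^ n \<le> exp ((sqrt (real n))\<^sup>2 / 2 - 0)"
    by (rule hermite_coeff_bound) auto
  then have "\<bar>hermite_fun n x\<bar> \<le> sqrt (exp 1 * (real n + 1)) * 1"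
    by (intro le_of_coeff_le) auto
  then show ?thesis
    by simp
qed

text \<open>On the circle of radius \<open>sqrt n\<close> the hypothesis keeps the centre
  \<open>sqrt 2 * u\<close> of the Gaussian within half of the modulus of \<open>x\<close>, hence at
  least that far from \<open>x\<close>.\<close>

lemma hermite_fun_decay:
  assumes "8 * real n \<le> x\<^sup>2"
  shows "\<bar>hermite_fun n x\<bar> \<le> sqrt (exp 1 * (real n + 1)) * exp (- x\<^sup>2 / 8)"
proof (rule le_of_coeff_le)
  have c: "x\<^sup>2 / 8 \<le> (sqrt 2 * u - x)\<^sup>2 / 2" if u: "\<bar>u\<bar> \<le> sqrt (real n)" for u
  proof -
    have "u\<^sup>2 \<le> real n"
      using u by (rule sqrt_ge_absD)
    then have "(2 * (sqrt 2 * u))\<^sup>2 \<le> x\<^sup>2"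
      using assms by (simp add: power_mult_distrib)
    then have "\<bar>2 * (sqrt 2 * u)\<bar> \<le> \<bar>x\<bar>"
      by (simp only: abs_le_square_iff)
    then have "\<bar>x / 2\<bar> \<le> \<bar>sqrt 2 * u - x\<bar>"
      by arith
    then have "(x / 2)\<^sup>2 \<le> (sqrt 2 * u - x)\<^sup>2"
      by (simp only: abs_le_square_iff)
    then show ?thesis
      by (simp add: power_divide)
  qed
  have "\<bar>hermite_fun n x\<bar> / sqrt (fact n) * sqrt (real n) ^ n \<le>
      exp ((sqrt (real n))\<^sup>2 / 2 - x\<^sup>2 / 8)"
    by (rule hermite_coeff_bound[OF _ c]) auto
  then show "\<bar>hermite_fun n x\<bar> / sqrt (fact n) * sqrt (real n) ^ n \<le> exp (real n / 2) * exp (- x\<^sup>2 / 8)"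
    by (simp flip: exp_add)
qed simp

text \<open>The geometric factor comes from Cauchy's estimate on the circle of radius \<open>2 r\<close>.\<close>

lemma hermite_term_le:
  assumes "0 \<le> r"
  shows "\<bar>hermite_fun n x\<bar> / sqrt (fact n) * r ^ n \<le> exp (6 * r\<^sup>2) * exp (- x\<^sup>2 / 4) * (1 / 2) ^ n"
proof -
  \<comment> \<open>Adding \<open>u^2\<close> completes a square, so half of the Gaussian in
    \<open>x\<close> survives for every \<open>r\<close>. The price \<open>(2 r)^2\<close>, together
    with \<open>(2 r)^2 / 2\<close> from the kernel, makes up \<open>6 r^2\<close>.\<close>
  have c: "x\<^sup>2 / 4 - (2 * r)\<^sup>2 \<le> (sqrt 2 * u - x)\<^sup>2 / 2" if "\<bar>u\<bar> \<le> 2 * r" for u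
  proof -
    have "u\<^sup>2 \<le> (2 * r)\<^sup>2"
      using that by (metis abs_le_square_iff abs_of_nonneg abs_ge_zero order_trans)
    moreover have "(sqrt 2 * u - x)\<^sup>2 / 2 + u\<^sup>2 - x\<^sup>2 / 4 = (2 * sqrt 2 * u - x)\<^sup>2 / 4"
      by (simp add: power2_diff power_mult_distrib)
    moreover have "0 \<le> (2 * sqrt 2 * u - x)\<^sup>2 / 4"
      by simp
    ultimately show ?thesis
      by linarith
  qed
  have "\<bar>hermite_fun n x\<bar> / sqrt (fact n) * (2 * r) ^ n \<le> exp ((2 * r)\<^sup>2 / 2 - (x\<^sup>2 / 4 - (2 * r)\<^sup>2))"
    by (rule hermite_coeff_bound[OF _ c]) (use assms in auto)
  also have "\<dots> = exp (6 * r\<^sup>2) * exp (- x\<^sup>2 / 4)"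
    by (simp add: power_mult_distrib flip: exp_add)
  finally show ?thesis
    by (simp add: power_mult_distrib power_divide field_simps)
qed

section \<open>Integration of the kernel series and orthonormality\<close>

text \<open>The weight is the Gaussian of \<open>hermite_term_le\<close>. The class contains the
  integrable, the square integrable and the bounded measurable functions, so one interchange theorem
  serves them all.\<close>

definition gauss_integrable :: "(real \<Rightarrow> complex) \<Rightarrow> bool" where
  "gauss_integrable f \<longleftrightarrow> f \<in> borel_measurable borel \<and>
     integrable lborel (\<lambda>x. cmod (f x) * exp (- x\<^sup>2 / 4))"

lemma gauss_integrable_integrable:
  assumes "integrable lborel f"
  shows "gauss_integrable f"
proof -
  have [measurable]: "f \<in> borel_measurable borel"
    using borel_measurable_integrable[OF assms] by simp
  have "integrable lborel (\<lambda>x. cmod (f x) * exp (- x\<^sup>2 / 4))"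
    by (rule Bochner_Integration.integrable_bound[OF integrable_norm[OF assms]])
      (auto simp: mult_left_le)
  then show ?thesis
    by (simp add: gauss_integrable_def)
qed

lemma gaussian_integrable: "0 < a \<Longrightarrow> integrable lborel (\<lambda>x::real. exp (- a * x\<^sup>2))"
proof -
  assume a: "0 < a"
  have "integrable lborel (\<lambda>x::real. exp (- (0 + sqrt a * x)\<^sup>2))"
    using integrable_poly_gaussian[of 1] a
    by (subst (asm) lborel_integrable_real_affine_iff[of "sqrt a" _ 0, symmetric]) auto
  with a show ?thesis
    by (simp add: power_mult_distrib)
qed

lemma gauss_integrable_square_integrable:
  assumes "square_integrable f"
  shows "gauss_integrable f"
proof -
  have [measurable]: "f \<in> borel_measurable borel"
    using assms by (simp add: square_integrable_def)
  have "integrable lborel (\<lambda>x. (cmod (f x))\<^sup>2 + exp (- (1 / 2) * x\<^sup>2))"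
    using assms gaussian_integrable[of "1/2"] by (auto simp: square_integrable_def)
  then have "integrable lborel (\<lambda>x. cmod (f x) * exp (- x\<^sup>2 / 4))"
  proof (rule Bochner_Integration.integrable_bound)
    show "AE x in lborel. norm (cmod (f x) * exp (- x\<^sup>2 / 4)) \<le>
        norm ((cmod (f x))\<^sup>2 + exp (- (1 / 2) * x\<^sup>2))"
    proof (rule AE_I2)
      fix x :: real
      have "(exp (- x\<^sup>2 / 4))\<^sup>2 = exp (- (1 / 2) * x\<^sup>2)"
        by (simp flip: exp_of_nat_mult)
      then show "norm (cmod (f x) * exp (- x\<^sup>2 / 4)) \<le> norm ((cmod (f x))\<^sup>2 + exp (- (1 / 2) * x\<^sup>2))"
        using sum_squares_bound[of "cmod (f x)" "exp (- x\<^sup>2 / 4)"]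
          mult_nonneg_nonneg[OF norm_ge_zero[of "f x"] exp_ge_zero[of "- x\<^sup>2 / 4"]]
          exp_ge_zero[of "- (1 / 2) * x\<^sup>2"]
        unfolding real_norm_def by linarith
    qed
  qed simp
  then show ?thesis
    by (simp add: gauss_integrable_def)
qed

lemma gauss_integrable_bounded:
  assumes [measurable]: "f \<in> borel_measurable borel" and B: "\<And>x. cmod (f x) \<le> B"
  shows "gauss_integrable f"
proof -
  have "integrable lborel (\<lambda>x::real. B * exp (- (1 / 4) * x\<^sup>2))"
    using gaussian_integrable[of "1/4"] by auto
  then have "integrable lborel (\<lambda>x. cmod (f x) * exp (- x\<^sup>2 / 4))"
    by (rule Bochner_Integration.integrable_bound)
      (auto intro!: mult_mono order_trans[OF B] simp: abs_mult)
  then show ?thesis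
    by (simp add: gauss_integrable_def)
qed

text \<open>The factor \<open>(1 / 2) ^ n\<close> of \<open>hermite_term_le\<close> makes the
  integrals of the absolute values summable, so that summation and integration may be
  interchanged.\<close>

lemma gauss_integrable_hermite:
  assumes "gauss_integrable f"
  shows "integrable lborel (\<lambda>x. f x * of_real (hermite_fun n x))" (is ?A)
    and "integrable lborel (\<lambda>x. f x * hermite_kernel x z)" (is ?B)
    and "(\<lambda>n. (\<integral>x. f x * of_real (hermite_fun n x) \<partial>lborel) / of_real (sqrt (fact n)) * z ^ n) sums
      (\<integral>x. f x * hermite_kernel x z \<partial>lborel)" (is ?C)
proof -
  have [measurable]: "f \<in> borel_measurable borel"
    and int: "integrable lborel (\<lambda>x. cmod (f x) * exp (- x\<^sup>2 / 4))"
    using assms by (auto simp: gauss_integrable_def)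
  define t where "t z n x = f x * (of_real (hermite_fun n x / sqrt (fact n)) * z ^ n)" for z n x
  have t_bound: "cmod (t z n x) \<le> exp (6 * (cmod z)\<^sup>2) * (cmod (f x) * exp (- x\<^sup>2 / 4)) * (1 / 2) ^ n" for z n x
  proof -
    have "cmod (t z n x) = cmod (f x) * (\<bar>hermite_fun n x\<bar> / sqrt (fact n) * cmod z ^ n)"
      by (simp add: t_def norm_mult norm_power norm_divide)
    also have "\<dots> \<le> cmod (f x) * (exp (6 * (cmod z)\<^sup>2) * exp (- x\<^sup>2 / 4) * (1 / 2) ^ n)"
      by (intro mult_left_mono hermite_term_le) auto
    finally show ?thesis
      by (simp add: mult_ac)
  qed
  have t_int: "integrable lborel (t z n)" for z n
  proof -
    have "integrable lborel (\<lambda>x. exp (6 * (cmod z)\<^sup>2) * (cmod (f x) * exp (- x\<^sup>2 / 4)) * (1 / 2) ^ n)"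
      using int by auto
    then show ?thesis
    proof (rule Bochner_Integration.integrable_bound)
      show "t z n \<in> borel_measurable lborel"
        unfolding t_def by simp
      show "AE x in lborel. norm (t z n x) \<le>
          norm (exp (6 * (cmod z)\<^sup>2) * (cmod (f x) * exp (- x\<^sup>2 / 4)) * (1 / 2) ^ n)"
        unfolding real_norm_def by (intro AE_I2 order_trans[OF t_bound abs_ge_self])
    qed
  qed
  show ?A
  proof -
    \<comment> \<open>At \<open>z = 1\<close> the power of \<open>z\<close> disappears from the
      term.\<close>
    have "integrable lborel (\<lambda>x. of_real (sqrt (fact n)) * t 1 n x)"
      using t_int by (intro integrable_mult_right) auto
    then show ?thesis
      by (simp add: t_def)
  qed
  have geo: "summable (\<lambda>n. c * (1 / 2 :: real) ^ n)" for c
    by (intro summable_mult summable_geometric) auto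
  have s1: "AE x in lborel. summable (\<lambda>n. norm (t z n x))"
    by (intro AE_I2 summable_comparison_test'[OF geo]) (use t_bound in simp)
  have s2: "summable (\<lambda>n. \<integral>x. norm (t z n x) \<partial>lborel)"
  proof (rule summable_comparison_test'[OF geo])
    fix n
    have "(\<integral>x. norm (t z n x) \<partial>lborel) \<le>
        (\<integral>x. exp (6 * (cmod z)\<^sup>2) * (cmod (f x) * exp (- x\<^sup>2 / 4)) * (1 / 2) ^ n \<partial>lborel)"
      using int by (intro integral_mono t_bound integrable_norm t_int) auto
    then show "norm (\<integral>x. norm (t z n x) \<partial>lborel) \<le>
        (\<integral>x. exp (6 * (cmod z)\<^sup>2) * (cmod (f x) * exp (- x\<^sup>2 / 4)) \<partial>lborel) * (1 / 2) ^ n"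
      by (simp add: integral_nonneg_AE)
  qed
  have sum: "(\<Sum>n. t z n x) = f x * hermite_kernel x z" for x
    unfolding t_def using sums_mult[OF hermite_kernel_sums, of "f x" x z] by (rule sums_unique[symmetric])
  show ?B
    using integrable_suminf[OF t_int s1 s2] by (simp add: sum)
  have "(\<lambda>n. \<integral>x. t z n x \<partial>lborel) sums (\<integral>x. f x * hermite_kernel x z \<partial>lborel)"
    using sums_integral[OF t_int s1 s2] by (simp add: sum)
  moreover have "(\<integral>x. t z n x \<partial>lborel) =
      (\<integral>x. f x * of_real (hermite_fun n x) \<partial>lborel) / of_real (sqrt (fact n)) * z ^ n" for n
  proof -
    have "t z n = (\<lambda>x. (f x * of_real (hermite_fun n x)) * (z ^ n / of_real (sqrt (fact n))))"
      by (simp add: t_def fun_eq_iff)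
    then show ?thesis
      by simp
  qed
  ultimately show ?C
    by simp
qed

text \<open>Coefficients are compared twice: in \<open>z\<close>, the product integral
  \<open>exp (w * z)\<close> gives the integral of the kernel at \<open>w\<close> against
  \<open>hermite_fun n\<close>; in \<open>w\<close>, that integral is a single power
  \<open>w ^ n\<close>, up to a constant.\<close>

lemma hermite_fun_orthonormal:
  "(\<integral>x. complex_of_real (hermite_fun m x) * of_real (hermite_fun n x) \<partial>lborel) = (if m = n then 1 else 0)"
proof -
  have gk: "gauss_integrable (\<lambda>x. hermite_kernel x w)" for w
  proof (rule gauss_integrable_bounded)
    show "cmod (hermite_kernel x w) \<le> exp ((cmod w)\<^sup>2 / 2) / sqrt (sqrt pi)" for x
      unfolding norm_hermite_kernel by (intro divide_right_mono) auto
  qed simp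
  have 1: "(\<integral>x. hermite_kernel x w * of_real (hermite_fun n x) \<partial>lborel) / of_real (sqrt (fact n)) =
      w ^ n / fact n" for w n
  proof (rule power_series_coeff_unique)
    fix z
    show "(\<lambda>n. (\<integral>x. hermite_kernel x w * of_real (hermite_fun n x) \<partial>lborel) / of_real (sqrt (fact n)) * z ^ n)
        sums exp (w * z)"
      using gauss_integrable_hermite(3)[OF gk, of w z] hermite_kernel_product_integral[of w z]
      by (simp add: has_bochner_integral_iff)
    show "(\<lambda>n. w ^ n / fact n * z ^ n) sums exp (w * z)"
      using exp_converges[of "w * z"] by (simp add: power_mult_distrib scaleR_conv_of_real field_simps)
  qed
  have gh: "gauss_integrable (\<lambda>x. of_real (hermite_fun n x))"
    by (rule gauss_integrable_bounded[where B = "sqrt (exp 1 * (real n + 1))"])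
      (use hermite_fun_le in auto)
  have "(\<integral>x. of_real (hermite_fun n x) * of_real (hermite_fun m x) \<partial>lborel) / of_real (sqrt (fact m)) =
      (if m = n then 1 / of_real (sqrt (fact n)) else 0 :: complex)"
  proof (rule power_series_coeff_unique[where F = "\<lambda>w. w ^ n / of_real (sqrt (fact n))" and n = m
        and a = "\<lambda>m. (\<integral>x. of_real (hermite_fun n x) * of_real (hermite_fun m x) \<partial>lborel) / of_real (sqrt (fact m))"
        and b = "\<lambda>m. if m = n then 1 / of_real (sqrt (fact n)) else 0"])
    fix w :: complex
    have "(\<integral>x. hermite_kernel x w * of_real (hermite_fun n x) \<partial>lborel) = of_real (sqrt (fact n)) * w ^ n / fact n"
      using 1[of w n] by (simp add: field_simps)
    also have "\<dots> = w ^ n / of_real (sqrt (fact n))"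
    proof -
      have "complex_of_real (sqrt (fact n)) * of_real (sqrt (fact n)) = fact n"
        by (simp flip: of_real_mult)
      then show ?thesis
        by (simp add: field_simps)
    qed
    finally show "(\<lambda>m. (\<integral>x. of_real (hermite_fun n x) * of_real (hermite_fun m x) \<partial>lborel) /
        of_real (sqrt (fact m)) * w ^ m) sums (w ^ n / of_real (sqrt (fact n)))"
      using gauss_integrable_hermite(3)[OF gh, of w] by (simp add: mult.commute)
    show "(\<lambda>m. (if m = n then 1 / of_real (sqrt (fact n)) else 0) * w ^ m) sums (w ^ n / of_real (sqrt (fact n)))"
      using sums_single[of n "\<lambda>m. w ^ m / of_real (sqrt (fact n))"]
      by (rule back_subst[of "\<lambda>f. f sums _"]) auto
  qed
  then show ?thesis
    by (simp add: mult.commute split: if_splits)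
qed

text \<open>The character is bounded, so its integral against the kernel expands in powers of
  \<open>z\<close>. The argument \<open>- i z\<close> of the transformed kernel contributes the
  eigenvalue \<open>(- i) ^ n\<close>.\<close>

lemma fourier_hermite_fun:
  "(\<integral>y. of_real (hermite_fun n y) * exp (- \<i> * of_real (x * y)) \<partial>lborel) =
     of_real (sqrt (2 * pi)) * ((- \<i>) ^ n * of_real (hermite_fun n x))"
proof -
  have g: "gauss_integrable (\<lambda>y. exp (- \<i> * of_real (x * y)))"
    by (rule gauss_integrable_bounded[where B = 1])
      (auto intro!: borel_measurable_continuous_onI continuous_intros)
  have "(\<integral>y. exp (- \<i> * of_real (x * y)) * of_real (hermite_fun n y) \<partial>lborel) / of_real (sqrt (fact n)) =
      of_real (sqrt (2 * pi)) * (of_real (hermite_fun n x / sqrt (fact n)) * (- \<i>) ^ n)"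
  proof (rule power_series_coeff_unique)
    fix z
    have "(\<integral>y. exp (- \<i> * of_real (x * y)) * hermite_kernel y z \<partial>lborel) =
        of_real (sqrt (2 * pi)) * hermite_kernel x (- \<i> * z)"
      using fourier_hermite_kernel[of z x] by (simp add: has_bochner_integral_iff mult.commute)
    then show "(\<lambda>n. (\<integral>y. exp (- \<i> * of_real (x * y)) * of_real (hermite_fun n y) \<partial>lborel) /
        of_real (sqrt (fact n)) * z ^ n) sums (of_real (sqrt (2 * pi)) * hermite_kernel x (- \<i> * z))"
      using gauss_integrable_hermite(3)[OF g, of z] by simp
    show "(\<lambda>n. of_real (sqrt (2 * pi)) * (of_real (hermite_fun n x / sqrt (fact n)) * (- \<i>) ^ n) * z ^ n)
        sums (of_real (sqrt (2 * pi)) * hermite_kernel x (- \<i> * z))"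
      using sums_mult[OF hermite_kernel_sums[of x "- \<i> * z"], of "of_real (sqrt (2 * pi))"]
      by (simp only: power_mult_distrib mult.assoc)
  qed
  then show ?thesis
    by (simp add: field_simps)
qed

section \<open>Completeness of the Hermite functions\<close>

text \<open>Positive and negative part have the same transform, in particular the same mass
  (\<open>t = 0\<close>). Divided by a nonzero mass they are probability densities with equal
  characteristic functions, and Levy's uniqueness theorem applies.\<close>

lemma AE_zero_if_fourier_zero_real:
  fixes g :: "real \<Rightarrow> real"
  assumes g: "integrable lborel g" and zero: "\<And>t. (\<integral>x. g x *\<^sub>R iexp (t * x) \<partial>lborel) = 0"
  shows "AE x in lborel. g x = 0"
proof -
  have [measurable]: "g \<in> borel_measurable borel"
    using borel_measurable_integrable[OF g] by simp
  define p where "p x = max 0 (g x)" for x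
  define q where "q x = max 0 (- g x)" for x
  have [measurable]: "p \<in> borel_measurable borel" "q \<in> borel_measurable borel"
    unfolding p_def[abs_def] q_def[abs_def] by measurable
  have pq: "integrable lborel p" "integrable lborel q" "\<And>x. 0 \<le> p x" "\<And>x. 0 \<le> q x"
    "\<And>x. g x = p x - q x"
    unfolding p_def[abs_def] q_def[abs_def] using g by auto
  have int: "integrable lborel (\<lambda>x. f x *\<^sub>R iexp (t * x))" if "integrable lborel f" for f t
    by (rule Bochner_Integration.integrable_bound[OF that]) (use that in auto)
  have eq: "(\<integral>x. p x *\<^sub>R iexp (t * x) \<partial>lborel) = (\<integral>x. q x *\<^sub>R iexp (t * x) \<partial>lborel)" for t
    using zero[of t] int[OF pq(1), of t] int[OF pq(2), of t] by (simp add: pq(5) scaleR_diff_left)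
  define m where "m = (\<integral>x. p x \<partial>lborel)"
  have m: "m = (\<integral>x. q x \<partial>lborel)"
  proof -
    have "of_real (\<integral>x. p x \<partial>lborel) = complex_of_real (\<integral>x. q x \<partial>lborel)"
      using eq[of 0] by (simp add: scaleR_conv_of_real del: of_real_eq_iff)
    then show ?thesis
      by (simp add: m_def)
  qed
  show ?thesis
  proof (cases "m = 0")
    case True
    have "AE x in lborel. p x = 0" "AE x in lborel. q x = 0"
      using integral_nonneg_eq_0_iff_AE[OF pq(1)] integral_nonneg_eq_0_iff_AE[OF pq(2)] pq m True
      by (auto simp: m_def)
    then show ?thesis
      by eventually_elim (simp add: pq(5))
  next
    case False
    then have m0: "0 < m"
      using pq(3) by (simp add: m_def less_le integral_nonneg_AE)
    have dist: "real_distribution (density lborel (\<lambda>x. f x / m))"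
      if "integrable lborel f" "\<And>x. 0 \<le> f x" "m = (\<integral>x. f x \<partial>lborel)" for f
    proof -
      have "(\<integral>\<^sup>+x. ennreal (f x / m) \<partial>lborel) = ennreal (\<integral>x. f x / m \<partial>lborel)"
        using that m0 by (intro nn_integral_eq_integral) auto
      also have "\<dots> = 1"
        using that(3) m0 by simp
      finally show ?thesis
        using that by (auto intro!: real_distribution.intro prob_spaceI
            simp: emeasure_density real_distribution_axioms_def)
    qed
    have "char (density lborel (\<lambda>x. p x / m)) = char (density lborel (\<lambda>x. q x / m))"
    proof
      fix t
      have "char (density lborel (\<lambda>x. f x / m)) t = (\<integral>x. f x *\<^sub>R iexp (t * x) \<partial>lborel) /\<^sub>R m"
        if [measurable]: "f \<in> borel_measurable borel" and "\<And>x. 0 \<le> f x" for f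
        unfolding char_def using m0 that(2)
        by (subst integral_density) (auto simp: divide_inverse_commute simp flip: scaleR_scaleR)
      then show "char (density lborel (\<lambda>x. p x / m)) t = char (density lborel (\<lambda>x. q x / m)) t"
        using pq eq by simp
    qed
    then have "density lborel (\<lambda>x. p x / m) = density lborel (\<lambda>x. q x / m)"
      by (intro Levy_uniqueness dist) (use pq m m_def in auto)
    then have "AE x in lborel. ennreal (p x / m) = ennreal (q x / m)"
      by (intro sigma_finite_measure.density_unique[OF sigma_finite_lborel]) auto
    then show ?thesis
      by eventually_elim (use pq m0 in simp)
  qed
qed

text \<open>Conjugation turns the transform at \<open>t\<close> into the one at \<open>- t\<close>,
  so \<open>cnj (g x)\<close>, and with it the real and imaginary parts of \<open>g\<close>, have
  vanishing transforms.\<close>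

lemma AE_zero_if_fourier_zero:
  fixes g :: "real \<Rightarrow> complex"
  assumes g: "integrable lborel g" and zero: "\<And>t. (\<integral>x. g x * iexp (t * x) \<partial>lborel) = 0"
  shows "AE x in lborel. g x = 0"
proof -
  have meas: "g \<in> borel_measurable borel"
    using borel_measurable_integrable[OF g] by simp
  have int: "integrable lborel (\<lambda>x. h x * iexp (t * x))" if "integrable lborel h" for h t
    by (rule Bochner_Integration.integrable_bound[OF that]) (use that in \<open>auto simp: norm_mult\<close>)
  have intc: "integrable lborel (\<lambda>x. cnj (g x))"
    using g by simp
  have zeroc: "(\<integral>x. cnj (g x) * iexp (t * x) \<partial>lborel) = 0" for t
  proof -
    have "(\<integral>x. cnj (g x) * iexp (t * x) \<partial>lborel) = (\<integral>x. cnj (g x * iexp (- t * x)) \<partial>lborel)"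
      by (simp add: exp_cnj)
    also have "\<dots> = cnj (\<integral>x. g x * iexp (- t * x) \<partial>lborel)"
      by (rule Bochner_Integration.integral_cnj)
    finally show ?thesis
      by (simp only: zero) simp
  qed
  have "(\<integral>x. Re (g x) *\<^sub>R iexp (t * x) \<partial>lborel) = 0" for t
  proof -
    have *: "Re (g x) *\<^sub>R iexp (t * x) = (g x * iexp (t * x) + cnj (g x) * iexp (t * x)) / 2" for x
      by (simp add: scaleR_conv_of_real complex_add_cnj flip: distrib_right)
    show ?thesis
      unfolding * Bochner_Integration.integral_divide_zero
        Bochner_Integration.integral_add[OF int[OF g] int[OF intc]] by (simp only: zero zeroc) simp
  qed
  moreover have "(\<integral>x. Im (g x) *\<^sub>R iexp (t * x) \<partial>lborel) = 0" for t
  proof -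
    have *: "Im (g x) *\<^sub>R iexp (t * x) = (g x * iexp (t * x) - cnj (g x) * iexp (t * x)) / (2 * \<i>)" for x
      proof -
      have "complex_of_real (Im (g x)) = (g x - cnj (g x)) / (2 * \<i>)"
        by (simp add: complex_eq_iff)
      then show ?thesis
        by (simp only: scaleR_conv_of_real times_divide_eq_left left_diff_distrib)
    qed
    show ?thesis
      unfolding * Bochner_Integration.integral_divide_zero
        Bochner_Integration.integral_diff[OF int[OF g] int[OF intc]] by (simp only: zero zeroc) simp
  qed
  ultimately have "AE x in lborel. Re (g x) = 0" "AE x in lborel. Im (g x) = 0"
    using g by (auto intro!: AE_zero_if_fourier_zero_real integrable_Re integrable_Im)
  then show ?thesis
    by eventually_elim (simp add: complex_eq_iff)
qed

text \<open>All Taylor coefficients of the integral of \<open>f\<close> against the kernel vanish,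
  so it is zero for every \<open>z\<close>. At \<open>z = i t / sqrt 2\<close> it is a nonzero
  multiple of the Fourier integral of \<open>f x * exp (- x^2 / 2)\<close>.\<close>

lemma hermite_complete:
  assumes f: "gauss_integrable f"
    and zero: "\<And>n. (\<integral>x. f x * of_real (hermite_fun n x) \<partial>lborel) = 0"
  shows "AE x in lborel. f x = 0"
proof -
  have kernel: "(\<integral>x. f x * hermite_kernel x z \<partial>lborel) = 0" for z
    using gauss_integrable_hermite(3)[OF f, of z] by (simp add: zero sums_iff)
  define c where "c = complex_of_real (sqrt (sqrt pi))"
  have c: "c \<noteq> 0"
    by (simp add: c_def)
  have eq: "f x * hermite_kernel x (\<i> * of_real (t / sqrt 2)) =
      f x * exp (- of_real (x\<^sup>2 / 2)) * iexp (t * x) * (exp (of_real (t\<^sup>2 / 4)) / c)" for x t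
  proof -
    have "- (\<i> * of_real (t / sqrt 2))\<^sup>2 / 2 + of_real (sqrt 2 * x) * (\<i> * of_real (t / sqrt 2)) - of_real (x\<^sup>2 / 2)
        = - of_real (x\<^sup>2 / 2) + \<i> * of_real (t * x) + complex_of_real (t\<^sup>2 / 4)"
      by (simp add: complex_eq_iff power_divide power_mult_distrib Re_power2 Im_power2)
    then have "hermite_kernel x (\<i> * of_real (t / sqrt 2)) =
        exp (- of_real (x\<^sup>2 / 2)) * iexp (t * x) * exp (of_real (t\<^sup>2 / 4)) / c"
      unfolding hermite_kernel_def c_def by (simp only: exp_add)
    then show ?thesis
      by simp
  qed
  have "AE x in lborel. f x * exp (- of_real (x\<^sup>2 / 2)) = 0"
  proof (rule AE_zero_if_fourier_zero)
    have "integrable lborel (\<lambda>x. c * (f x * hermite_kernel x (\<i> * of_real (0 / sqrt 2))))"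
      by (intro integrable_mult_right gauss_integrable_hermite(2)[OF f])
    then show "integrable lborel (\<lambda>x. f x * exp (- of_real (x\<^sup>2 / 2)))"
      unfolding eq using c by simp
    show "(\<integral>x. f x * exp (- of_real (x\<^sup>2 / 2)) * iexp (t * x) \<partial>lborel) = 0" for t
      using kernel[of "\<i> * of_real (t / sqrt 2)"] c unfolding eq by simp
  qed
  then show ?thesis
    by simp
qed

section \<open>Decay estimates\<close>

definition fourier :: "(real \<Rightarrow> complex) \<Rightarrow> real \<Rightarrow> complex" where
  "fourier f \<xi> = complex_of_real (1 / sqrt (2 * pi)) *
     (\<integral>x. f x * exp (- \<i> * complex_of_real (\<xi> * x)) \<partial>lborel)"

lemma fourier_measurable [measurable]:
  assumes [measurable]: "f \<in> borel_measurable borel"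
  shows "fourier f \<in> borel_measurable borel"
proof -
  have [measurable]: "(\<lambda>p :: real \<times> real. exp (- \<i> * complex_of_real (fst p * snd p))) \<in> borel_measurable borel"
    by (intro borel_measurable_continuous_onI continuous_intros)
  have "(\<lambda>(\<xi>, x). f x * exp (- \<i> * complex_of_real (\<xi> * x))) \<in> borel_measurable (borel \<Otimes>\<^sub>M lborel)"
    by (simp add: case_prod_beta' borel_prod)
  then have "(\<lambda>\<xi>. \<integral>x. f x * exp (- \<i> * complex_of_real (\<xi> * x)) \<partial>lborel) \<in> borel_measurable borel"
    by (rule lborel.borel_measurable_lebesgue_integral)
  then show ?thesis
    unfolding fourier_def[abs_def] by measurable
qed

text \<open>Since \<open>- i * (i * z) = z\<close>, the kernel at \<open>z\<close> is the transform
  of the kernel at \<open>i * z\<close>, and Fubini's theorem moves the transform over to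
  \<open>f\<close>.\<close>

lemma kernel_integral_fourier:
  assumes f: "integrable lborel f"
  shows "(\<integral>x. f x * hermite_kernel x z \<partial>lborel) =
    (\<integral>\<xi>. fourier f \<xi> * hermite_kernel \<xi> (\<i> * z) \<partial>lborel)"
proof -
  have [measurable]: "f \<in> borel_measurable borel"
    using borel_measurable_integrable[OF f] by simp
  define g where "g \<xi> = hermite_kernel \<xi> (\<i> * z)" for \<xi>
  have [measurable]: "g \<in> borel_measurable borel"
    unfolding g_def[abs_def] by simp
  have g_int: "integrable lborel g"
    using fourier_hermite_kernel[of "\<i> * z" 0] by (simp add: g_def[abs_def] has_bochner_integral_iff)
  define e where "e x \<xi> = exp (- \<i> * complex_of_real (x * \<xi>))" for x \<xi>
  have e: "cmod (e x \<xi>) = 1" for x \<xi>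
    by (simp add: e_def)
  have [measurable]: "(\<lambda>p. e (fst p) (snd p)) \<in> borel_measurable borel"
    unfolding e_def by (intro borel_measurable_continuous_onI continuous_intros)
  have kernel: "hermite_kernel x z = (\<integral>\<xi>. g \<xi> * e x \<xi> \<partial>lborel) / of_real (sqrt (2 * pi))" for x
  proof -
    have "- \<i> * (\<i> * z) = z"
      by (simp add: mult.assoc[symmetric])
    then show ?thesis
      using fourier_hermite_kernel[of "\<i> * z" x] unfolding g_def e_def
      by (simp add: has_bochner_integral_iff)
  qed
  have int: "integrable (lborel \<Otimes>\<^sub>M lborel) (case_prod (\<lambda>x \<xi>. f x * (g \<xi> * e x \<xi>)))"
  proof (rule lborel_pair.Fubini_integrable)
    have [measurable]: "(fst :: real \<times> real \<Rightarrow> real) \<in> borel_measurable borel"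
      "(snd :: real \<times> real \<Rightarrow> real) \<in> borel_measurable borel"
      by (intro borel_measurable_continuous_onI continuous_intros)+
    have "(\<lambda>p. f (fst p) * (g (snd p) * e (fst p) (snd p))) \<in> borel_measurable borel"
      by measurable
    then show "(\<lambda>(x, \<xi>). f x * (g \<xi> * e x \<xi>)) \<in> borel_measurable (lborel \<Otimes>\<^sub>M lborel)"
      by (simp add: case_prod_beta' lborel_prod)
    have "(\<integral>\<xi>. norm (f x * (g \<xi> * e x \<xi>)) \<partial>lborel) = cmod (f x) * (\<integral>\<xi>. cmod (g \<xi>) \<partial>lborel)" for x
      by (simp add: norm_mult e)
    then show "integrable lborel (\<lambda>x. \<integral>\<xi>. norm (case (x, \<xi>) of (x, \<xi>) \<Rightarrow> f x * (g \<xi> * e x \<xi>)) \<partial>lborel)"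
      using f by simp
    have "integrable lborel (\<lambda>\<xi>. g \<xi> * e x \<xi>)" for x
      using fourier_hermite_kernel[of "\<i> * z" x] unfolding g_def e_def
      by (simp add: has_bochner_integral_iff)
    then show "AE x in lborel. integrable lborel (\<lambda>\<xi>. case (x, \<xi>) of (x, \<xi>) \<Rightarrow> f x * (g \<xi> * e x \<xi>))"
      by simp
  qed
  have "(\<integral>x. f x * hermite_kernel x z \<partial>lborel) =
      (\<integral>x. (\<integral>\<xi>. f x * (g \<xi> * e x \<xi>) \<partial>lborel) \<partial>lborel) / of_real (sqrt (2 * pi))"
    by (simp add: kernel)
  also have "(\<integral>x. (\<integral>\<xi>. f x * (g \<xi> * e x \<xi>) \<partial>lborel) \<partial>lborel) =
      (\<integral>\<xi>. (\<integral>x. f x * (g \<xi> * e x \<xi>) \<partial>lborel) \<partial>lborel)"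
    by (rule lborel_pair.Fubini_integral[OF int, symmetric])
  also have "\<dots> = (\<integral>\<xi>. g \<xi> * (\<integral>x. f x * e x \<xi> \<partial>lborel) \<partial>lborel)"
  proof -
    have "f x * (g \<xi> * e x \<xi>) = g \<xi> * (f x * e x \<xi>)" for x \<xi>
      by simp
    then show ?thesis
      by (simp only: Bochner_Integration.integral_mult_right_zero)
  qed
  finally show ?thesis
    by (simp add: fourier_def g_def e_def mult.commute mult.left_commute)
qed

section \<open>Estimates for a weight of at most quadratic growth\<close>

text \<open>\<open>\<mu>\<close> stands for a multiple \<open>l * \<omega> t\<close>; the
  assumptions feel the multiple only through \<open>D\<close> and the constants of
  \<open>ln_growth\<close>. The argument \<open>1 + t\<close> keeps the logarithm finite at
  \<open>t = 0\<close>.\<close>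

locale subquadratic_weight =
  fixes \<mu> :: "real \<Rightarrow> real" and D :: real
  assumes mono: "0 \<le> s \<Longrightarrow> s \<le> t \<Longrightarrow> \<mu> s \<le> \<mu> t"
    and nonneg: "0 \<le> t \<Longrightarrow> 0 \<le> \<mu> t"
    and le_square: "0 \<le> t \<Longrightarrow> \<mu> t \<le> t\<^sup>2 + D"
    and ln_growth: "\<exists>C. \<forall>t\<ge>0. M * ln (1 + t) \<le> \<mu> t + C"
begin

lemma abs_measurable [measurable]: "(\<lambda>x. \<mu> \<bar>c * x\<bar>) \<in> borel_measurable borel"
proof -
  \<comment> \<open>Only the half-line is controlled; \<open>max 0\<close> extends to a function
    monotone on the whole line, hence Borel.\<close>
  have "mono (\<lambda>t. \<mu> (max 0 t))"
    by (intro monoI mono) auto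
  then have [measurable]: "(\<lambda>t. \<mu> (max 0 t)) \<in> borel_measurable borel"
    by (rule borel_measurable_mono)
  have "(\<lambda>x. \<mu> (max 0 \<bar>c * x\<bar>)) \<in> borel_measurable borel"
    by measurable
  then show ?thesis
    by simp
qed

lemma exp_decay:
  assumes "0 < c"
  obtains C where "0 < C" "\<And>t. 0 \<le> t \<Longrightarrow> exp (- c * \<mu> t) \<le> C * (1 + t) powr - k"
proof -
  obtain C where C: "\<And>t. 0 \<le> t \<Longrightarrow> (k / c) * ln (1 + t) \<le> \<mu> t + C"
    using ln_growth[of "k / c"] by blast
  have "exp (- c * \<mu> t) \<le> exp (c * C) * (1 + t) powr - k" if "0 \<le> t" for t
  proof -
    have "c * ((k / c) * ln (1 + t)) \<le> c * (\<mu> t + C)"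
      using C[OF that] assms by (intro mult_left_mono) auto
    then have "- c * \<mu> t \<le> c * C + - k * ln (1 + t)"
      using assms by (simp add: algebra_simps)
    then have "exp (- c * \<mu> t) \<le> exp (c * C) * exp (- k * ln (1 + t))"
      by (simp flip: exp_add)
    then show ?thesis
      using that by (simp add: powr_def)
  qed
  then show thesis
    using that[of "exp (c * C)"] by simp
qed

lemma exp_integrable:
  assumes "0 < a" "0 < c"
  shows "integrable lborel (\<lambda>x. exp (- c * \<mu> \<bar>a * x\<bar>))"
proof -
  obtain C where C: "0 < C" "\<And>t. 0 \<le> t \<Longrightarrow> exp (- c * \<mu> t) \<le> C * (1 + t) powr - 2"
    using exp_decay[OF assms(2), of 2] by blast
  have "integrable lborel (\<lambda>x::real. inverse (1 + x\<^sup>2))"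
    using integrable_inverse_1_plus_square by (simp add: set_integrable_def)
  then have "integrable lborel (\<lambda>x. inverse (1 + (0 + a * x)\<^sup>2))"
    using assms by (subst lborel_integrable_real_affine_iff) auto
  then have "integrable lborel (\<lambda>x. C * inverse (1 + (a * x)\<^sup>2))"
    by simp
  then show ?thesis
  proof (rule Bochner_Integration.integrable_bound)
    show "AE x in lborel. norm (exp (- c * \<mu> \<bar>a * x\<bar>)) \<le> norm (C * inverse (1 + (a * x)\<^sup>2))"
    proof (rule AE_I2)
      fix x
      have "1 + (a * x)\<^sup>2 \<le> (1 + \<bar>a * x\<bar>)\<^sup>2"
        by (simp add: power2_sum)
      then have "inverse ((1 + \<bar>a * x\<bar>)\<^sup>2) \<le> inverse (1 + (a * x)\<^sup>2)"
        by (intro le_imp_inverse_le) (auto simp: add_pos_nonneg)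
      moreover have "(1 + \<bar>a * x\<bar>) powr - 2 = inverse ((1 + \<bar>a * x\<bar>)\<^sup>2)"
        by (simp add: powr_minus powr_numeral add_pos_nonneg)
      ultimately have "C * (1 + \<bar>a * x\<bar>) powr - 2 \<le> C * inverse (1 + (a * x)\<^sup>2)"
        using C(1) by simp
      moreover have "0 \<le> C * inverse (1 + (a * x)\<^sup>2)"
        using C(1) by simp
      ultimately show "norm (exp (- c * \<mu> \<bar>a * x\<bar>)) \<le> norm (C * inverse (1 + (a * x)\<^sup>2))"
        using C(2)[of "\<bar>a * x\<bar>"] by simp
    qed
  qed measurable
qed

lemma exp_summable:
  assumes "0 < c"
  shows "summable (\<lambda>n. sqrt (exp 1 * (real n + 1)) * exp (- c * \<mu> (sqrt (real n))))"
proof -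
  \<comment> \<open>The exponent 6 becomes \<open>m ^ 3\<close> for \<open>m = n + 1\<close>; one
    power of \<open>m\<close> pays for \<open>sqrt m\<close> and two remain for summability.\<close>
  obtain C where C: "0 < C" "\<And>t. 0 \<le> t \<Longrightarrow> exp (- c * \<mu> t) \<le> C * (1 + t) powr - 6"
    using exp_decay[OF assms, of 6] by blast
  have "summable (\<lambda>n. inverse (real (Suc n) ^ 2))"
    using inverse_power_summable[of 2, where 'a = real] by (subst summable_Suc_iff) auto
  then have "summable (\<lambda>n. sqrt (exp 1) * C * inverse (real (Suc n) ^ 2))"
    by (rule summable_mult)
  then show ?thesis
  proof (rule summable_comparison_test')
    fix n
    define m where "m = real n + 1"
    have m: "1 \<le> m" by (simp add: m_def)
    have "m \<le> (1 + sqrt (real n))\<^sup>2"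
      by (simp add: m_def power2_sum)
    then have "m ^ 3 \<le> ((1 + sqrt (real n))\<^sup>2) ^ 3"
      using m by (intro power_mono) auto
    then have "inverse ((1 + sqrt (real n)) ^ 6) \<le> inverse (m ^ 3)"
      using m by (intro le_imp_inverse_le) (auto simp flip: power_mult)
    moreover have "(1 + sqrt (real n)) powr - 6 = inverse ((1 + sqrt (real n)) ^ 6)"
      by (simp add: powr_minus powr_numeral add_pos_nonneg)
    ultimately have e: "exp (- c * \<mu> (sqrt (real n))) \<le> C * inverse (m ^ 3)"
      using C(2)[of "sqrt n"] C(1) by (smt (verit) mult_left_mono real_sqrt_ge_zero of_nat_0_le_iff)
    have "m * 1 \<le> m * m"
      using m by (intro mult_left_mono) auto
    then have "sqrt m \<le> m"
      using m by (intro real_le_lsqrt) (auto simp: power2_eq_square)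
    then have "sqrt (exp 1) * sqrt m * exp (- c * \<mu> (sqrt (real n))) \<le> sqrt (exp 1) * m * (C * inverse (m ^ 3))"
      using e m by (intro mult_mono) auto
    also have "\<dots> = sqrt (exp 1) * C * inverse (m ^ 2)"
      using m by (simp add: field_simps power2_eq_square power3_eq_cube)
    finally show "norm (sqrt (exp 1 * (real n + 1)) * exp (- c * \<mu> (sqrt (real n)))) \<le>
        sqrt (exp 1) * C * inverse (real (Suc n) ^ 2)"
      by (simp add: m_def real_sqrt_mult abs_mult add.commute)
  qed
qed

text \<open>The Gaussian is centred at \<open>u\<close>, of modulus at least \<open>r\<close>, so
  either \<open>x\<close> or \<open>u - x\<close> has modulus at least \<open>r / 2\<close>. The
  decay of \<open>f\<close> settles the first case; in the second the Gaussian decays fast enough by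
  \<open>le_square\<close>.\<close>

lemma kernel_integral_bound:
  assumes f: "gauss_integrable f" and A: "0 \<le> A"
    and bound: "AE x in lborel. cmod (f x) \<le> A * exp (- \<mu> \<bar>x\<bar>)"
    and z: "cmod z = r" "r \<le> sqrt 2 * \<bar>Re z\<bar>"
  shows "cmod (\<integral>x. f x * hermite_kernel x z \<partial>lborel) \<le>
    exp (r\<^sup>2 / 2) * (A * (exp (\<bar>D\<bar> / 4) * (\<integral>x. exp (- (x::real)\<^sup>2 / 4) \<partial>lborel)) * exp (- \<mu> (r / 2) / 4))"
proof -
  define u where "u = sqrt 2 * Re z"
  define c where "c = exp (r\<^sup>2 / 2) * A * exp (\<bar>D\<bar> / 4) * exp (- \<mu> (r / 2) / 4)"
  have r: "0 \<le> r" "r \<le> \<bar>u\<bar>"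
    using z by (auto simp: u_def abs_mult)
  \<comment> \<open>Half of the Gaussian exponent, \<open>(u - x)^2 / 4\<close>, is kept for the
    integration over \<open>x\<close>; the other half accounts for the divisor 4 of
    \<open>\<mu> (r / 2)\<close> and of \<open>D\<close>.\<close>
  have exponent: "- \<mu> \<bar>x\<bar> - (u - x)\<^sup>2 / 2 \<le> \<bar>D\<bar> / 4 - \<mu> (r / 2) / 4 - (u - x)\<^sup>2 / 4" for x
  proof (cases "r / 2 \<le> \<bar>x\<bar>")
    case True
    then have "\<mu> (r / 2) \<le> \<mu> \<bar>x\<bar>" "0 \<le> \<mu> (r / 2)"
      using r by (auto intro: mono nonneg)
    then show ?thesis
      using zero_le_power2[of "u - x"] by linarith
  next
    case False
    then have "\<bar>r / 2\<bar> \<le> \<bar>u - x\<bar>"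
      using r by arith
    then have "(r / 2)\<^sup>2 \<le> (u - x)\<^sup>2"
      by (simp only: abs_le_square_iff)
    moreover have "\<mu> (r / 2) \<le> (r / 2)\<^sup>2 + D"
      using r by (intro le_square) auto
    moreover have "0 \<le> \<mu> \<bar>x\<bar>"
      by (rule nonneg) simp
    ultimately show ?thesis
      by linarith
  qed
  have pointwise: "AE x in lborel. cmod (f x * hermite_kernel x z) \<le> c * exp (- (u - x)\<^sup>2 / 4)"
    using bound
  proof eventually_elim
    fix x assume x: "cmod (f x) \<le> A * exp (- \<mu> \<bar>x\<bar>)"
    have "1 \<le> sqrt (sqrt pi)"
      using pi_ge_two by simp
    then have "exp (r\<^sup>2 / 2 - (u - x)\<^sup>2 / 2) / sqrt (sqrt pi) \<le> exp (r\<^sup>2 / 2 - (u - x)\<^sup>2 / 2) / 1"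
      by (intro frac_le) auto
    then have "cmod (hermite_kernel x z) \<le> exp (r\<^sup>2 / 2 - (u - x)\<^sup>2 / 2)"
      by (simp add: norm_hermite_kernel z(1) u_def)
    then have "cmod (f x * hermite_kernel x z) \<le> (A * exp (- \<mu> \<bar>x\<bar>)) * exp (r\<^sup>2 / 2 - (u - x)\<^sup>2 / 2)"
      unfolding norm_mult using x A by (intro mult_mono) auto
    also have "\<dots> = A * exp (r\<^sup>2 / 2 + (- \<mu> \<bar>x\<bar> - (u - x)\<^sup>2 / 2))"
      by (simp add: mult.assoc flip: exp_add)
    also have "\<dots> \<le> A * exp (r\<^sup>2 / 2 + (\<bar>D\<bar> / 4 - \<mu> (r / 2) / 4 - (u - x)\<^sup>2 / 4))"
      using A exponent[of x] by (intro mult_left_mono) auto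
    also have "\<dots> = c * exp (- (u - x)\<^sup>2 / 4)"
    proof -
      have "exp (r\<^sup>2 / 2 + (\<bar>D\<bar> / 4 - \<mu> (r / 2) / 4 - (u - x)\<^sup>2 / 4)) =
          exp (r\<^sup>2 / 2) * exp (\<bar>D\<bar> / 4) * exp (- \<mu> (r / 2) / 4) * exp (- (u - x)\<^sup>2 / 4)"
        by (simp flip: exp_add)
      then show ?thesis
        by (simp only: c_def mult_ac)
    qed
    finally show "cmod (f x * hermite_kernel x z) \<le> c * exp (- (u - x)\<^sup>2 / 4)" .
  qed
  have g: "integrable lborel (\<lambda>x::real. exp (- x\<^sup>2 / 4))"
    using gaussian_integrable[of "1/4"] by simp
  have gi: "integrable lborel (\<lambda>x. exp (- (u - x)\<^sup>2 / 4))"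
    using lborel_integrable_real_affine[OF g, of "-1" u] by simp
  have "cmod (\<integral>x. f x * hermite_kernel x z \<partial>lborel) \<le> (\<integral>x. cmod (f x * hermite_kernel x z) \<partial>lborel)"
    by (rule integral_norm_bound)
  also have "\<dots> \<le> (\<integral>x. c * exp (- (u - x)\<^sup>2 / 4) \<partial>lborel)"
    using gi by (intro integral_mono_AE pointwise integrable_norm gauss_integrable_hermite(2)[OF f]) auto
  also have "\<dots> = c * (\<integral>x. exp (- (x::real)\<^sup>2 / 4) \<partial>lborel)"
    using lborel_integral_real_affine[of "-1" "\<lambda>x::real. exp (- x\<^sup>2 / 4)" u] by simp
  finally show ?thesis
    by (simp add: c_def mult_ac)
qed

lemma integrable_of_decay:
  assumes "f \<in> borel_measurable borel" "AE x in lborel. cmod (f x) \<le> A * exp (- \<mu> \<bar>x\<bar>)"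
  shows "integrable lborel f"
proof (rule Bochner_Integration.integrable_bound)
  show "integrable lborel (\<lambda>x. A * exp (- 1 * \<mu> \<bar>1 * x\<bar>))"
    by (intro integrable_mult_right exp_integrable) auto
  show "AE x in lborel. norm (f x) \<le> norm (A * exp (- 1 * \<mu> \<bar>1 * x\<bar>))"
    using assms(2) by eventually_elim simp
qed (use assms in simp)

definition coeff_const :: real where
  "coeff_const = exp (\<bar>D\<bar> / 4) * (\<integral>x. exp (- (x::real)\<^sup>2 / 4) \<partial>lborel)"

text \<open>On the circle of radius \<open>sqrt n\<close> one of the real and imaginary parts of \<open>z\<close> is large;
  in the second case the transform of \<open>f\<close> takes over the role of \<open>f\<close>, because the kernel
  is turned by a right angle.\<close>

lemma hermite_coeff_decay:
  assumes meas: "f \<in> borel_measurable borel" and A: "0 \<le> A"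
    and f: "AE x in lborel. cmod (f x) \<le> A * exp (- \<mu> \<bar>x\<bar>)"
    and F: "\<And>\<xi>. cmod (fourier f \<xi>) \<le> A * exp (- \<mu> \<bar>\<xi>\<bar>)"
  shows "cmod (\<integral>x. f x * of_real (hermite_fun n x) \<partial>lborel) \<le>
    sqrt (exp 1 * (real n + 1)) * (A * coeff_const * exp (- \<mu> (sqrt (real n) / 2) / 4))"
proof (rule le_of_coeff_le)
  have f_int: "integrable lborel f"
    by (rule integrable_of_decay[OF meas f])
  have F_int: "integrable lborel (fourier f)"
    by (rule integrable_of_decay[OF fourier_measurable[OF meas]]) (use F in auto)
  define r where "r = sqrt (real n)"
  let ?B = "exp (r\<^sup>2 / 2) * (A * coeff_const * exp (- \<mu> (r / 2) / 4))"
  have bound: "cmod (\<integral>x. f x * hermite_kernel x z \<partial>lborel) \<le> ?B" if z: "cmod z = r" for z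
  proof (cases "r \<le> sqrt 2 * \<bar>Re z\<bar>")
    case True
    then show ?thesis
      using kernel_integral_bound[OF gauss_integrable_integrable[OF f_int] A f z]
      by (simp add: coeff_const_def)
  next
    case False
    have "r \<le> sqrt 2 * \<bar>Im z\<bar>"
    proof (rule ccontr)
      assume "\<not> r \<le> sqrt 2 * \<bar>Im z\<bar>"
      then have "(sqrt 2 * \<bar>Re z\<bar>)\<^sup>2 < r\<^sup>2" "(sqrt 2 * \<bar>Im z\<bar>)\<^sup>2 < r\<^sup>2"
        using False by (auto intro!: power_strict_mono)
      then show False
        using cmod_power2[of z] z by (simp add: power_mult_distrib)
    qed
    then have "cmod (\<integral>\<xi>. fourier f \<xi> * hermite_kernel \<xi> (\<i> * z) \<partial>lborel) \<le> ?B"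
      unfolding coeff_const_def
      by (intro kernel_integral_bound gauss_integrable_integrable F_int A)
        (use F z in \<open>auto simp: norm_mult\<close>)
    then show ?thesis
      by (simp only: kernel_integral_fourier[OF f_int])
  qed
  have "cmod ((\<integral>x. f x * of_real (hermite_fun n x) \<partial>lborel) / of_real (sqrt (fact n))) * r ^ n \<le> ?B"
    by (rule power_series_coeff_bound[OF gauss_integrable_hermite(3)[OF gauss_integrable_integrable[OF f_int]] bound])
      (auto simp: r_def)
  then show "cmod (\<integral>x. f x * of_real (hermite_fun n x) \<partial>lborel) / sqrt (fact n) * sqrt (real n) ^ n \<le>
      exp (real n / 2) * (A * coeff_const * exp (- \<mu> (sqrt (real n) / 2) / 4))"
    by (simp add: r_def norm_divide)
  show "0 \<le> A * coeff_const * exp (- \<mu> (sqrt (real n) / 2) / 4)"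
    using A by (simp add: coeff_const_def integral_nonneg_AE)
qed

end

section \<open>Hermite series with decaying coefficients\<close>

definition hermite_series :: "(nat \<Rightarrow> complex) \<Rightarrow> real \<Rightarrow> complex" where
  "hermite_series \<alpha> x = (\<Sum>n. \<alpha> n * of_real (hermite_fun n x))"

context subquadratic_weight
begin

definition series_const :: real where
  "series_const = exp (\<bar>D\<bar> / 8) *
     (\<Sum>n. sqrt (exp 1 * (real n + 1)) * exp (- (1 / 2) * \<mu> (sqrt (real n))))"

text \<open>If \<open>8 n <= x^2\<close>, the factor \<open>exp (- x^2 / 8)\<close> of the Hermite
  function gives the decay in \<open>x\<close> by \<open>le_square\<close>. Otherwise a quarter of
  the modulus of \<open>x\<close> is at most \<open>sqrt n\<close>, and half of the decay of the
  coefficient gives it. Either way \<open>\<mu> (sqrt n) / 2\<close> is left for the sum over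
  \<open>n\<close>.\<close>

lemma hermite_term_decay:
  assumes \<alpha>: "cmod (\<alpha> n) \<le> A * exp (- \<mu> (sqrt (real n)))" and A: "0 \<le> A"
  shows "cmod (\<alpha> n * of_real (hermite_fun n x)) \<le> A * exp (\<bar>D\<bar> / 8) *
    (sqrt (exp 1 * (real n + 1)) * exp (- (1 / 2) * \<mu> (sqrt (real n)))) * exp (- (1 / 8) * \<mu> \<bar>1 / 4 * x\<bar>)"
proof -
  define s where "s = sqrt (exp 1 * (real n + 1))"
  have s: "0 \<le> s"
    by (simp add: s_def)
  have \<mu>0: "0 \<le> \<mu> (sqrt (real n))" "0 \<le> \<mu> \<bar>1 / 4 * x\<bar>"
    by (auto intro: nonneg)
  have main: "cmod (\<alpha> n * of_real (hermite_fun n x)) \<le> A * s * exp (- \<mu> (sqrt (real n)) - c)"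
    if "\<bar>hermite_fun n x\<bar> \<le> s * exp (- c)" for c
  proof -
    have "cmod (\<alpha> n * of_real (hermite_fun n x)) \<le> (A * exp (- \<mu> (sqrt (real n)))) * (s * exp (- c))"
      unfolding norm_mult norm_of_real using \<alpha> that A by (intro mult_mono) auto
    also have "\<dots> = A * s * (exp (- \<mu> (sqrt (real n))) * exp (- c))"
      by (simp only: mult_ac)
    finally show ?thesis
      by (simp flip: exp_add)
  qed
  let ?e = "\<bar>D\<bar> / 8 - (1 / 2) * \<mu> (sqrt (real n)) - (1 / 8) * \<mu> \<bar>1 / 4 * x\<bar>"
  have "cmod (\<alpha> n * of_real (hermite_fun n x)) \<le> A * s * exp ?e"
  proof (cases "8 * real n \<le> x\<^sup>2")
    case True
    have "cmod (\<alpha> n * of_real (hermite_fun n x)) \<le> A * s * exp (- \<mu> (sqrt (real n)) - x\<^sup>2 / 8)"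
      by (rule main) (use hermite_fun_decay[OF True] in \<open>simp add: s_def\<close>)
    moreover have "- \<mu> (sqrt (real n)) - x\<^sup>2 / 8 \<le> ?e"
      using le_square[of "\<bar>x\<bar>"] mono[of "\<bar>1 / 4 * x\<bar>" "\<bar>x\<bar>"] \<mu>0 by simp
    then have "A * s * exp (- \<mu> (sqrt (real n)) - x\<^sup>2 / 8) \<le> A * s * exp ?e"
      using A s by (intro mult_left_mono) auto
    ultimately show ?thesis
      by (rule order_trans)
  next
    case False
    have "cmod (\<alpha> n * of_real (hermite_fun n x)) \<le> A * s * exp (- \<mu> (sqrt (real n)) - 0)"
      by (rule main) (use hermite_fun_le[of n x] in \<open>simp add: s_def\<close>)
    moreover have "\<bar>1 / 4 * x\<bar> \<le> sqrt (real n)"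
      using False by (intro real_le_rsqrt) (simp add: power_divide)
    then have "\<mu> \<bar>1 / 4 * x\<bar> \<le> \<mu> (sqrt (real n))"
      by (intro mono) auto
    then have "- \<mu> (sqrt (real n)) - 0 \<le> ?e"
      using \<mu>0 by simp
    then have "A * s * exp (- \<mu> (sqrt (real n)) - 0) \<le> A * s * exp ?e"
      using A s by (intro mult_left_mono) auto
    ultimately show ?thesis
      by (rule order_trans)
  qed
  also have "exp ?e = exp (\<bar>D\<bar> / 8) * exp (- (1 / 2) * \<mu> (sqrt (real n))) *
      exp (- (1 / 8) * \<mu> \<bar>1 / 4 * x\<bar>)"
    by (simp flip: exp_add)
  also have "A * s * \<dots> = A * exp (\<bar>D\<bar> / 8) * (s * exp (- (1 / 2) * \<mu> (sqrt (real n)))) *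
      exp (- (1 / 8) * \<mu> \<bar>1 / 4 * x\<bar>)"
    by (simp only: mult_ac)
  finally show ?thesis
    by (simp only: s_def)
qed

context
  fixes \<alpha> :: "nat \<Rightarrow> complex" and A :: real
  assumes \<alpha>: "\<And>n. cmod (\<alpha> n) \<le> A * exp (- \<mu> (sqrt (real n)))" and A: "0 \<le> A"
begin

lemma hermite_series_summable: "summable (\<lambda>n. cmod (\<alpha> n * of_real (hermite_fun n x)))"
proof (rule summable_comparison_test')
  show "summable (\<lambda>n. A * exp (\<bar>D\<bar> / 8) *
    (sqrt (exp 1 * (real n + 1)) * exp (- (1 / 2) * \<mu> (sqrt (real n)))) * exp (- (1 / 8) * \<mu> \<bar>1 / 4 * x\<bar>))"
    by (intro summable_mult summable_mult2 exp_summable) auto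
  show "norm (cmod (\<alpha> n * of_real (hermite_fun n x))) \<le> A * exp (\<bar>D\<bar> / 8) *
    (sqrt (exp 1 * (real n + 1)) * exp (- (1 / 2) * \<mu> (sqrt (real n)))) * exp (- (1 / 8) * \<mu> \<bar>1 / 4 * x\<bar>)" for n
    unfolding real_norm_def abs_norm_cancel by (rule hermite_term_decay[OF \<alpha> A])
qed

lemma hermite_series_measurable: "hermite_series \<alpha> \<in> borel_measurable borel"
  unfolding hermite_series_def[abs_def] by measurable

lemma hermite_series_bound:
  "cmod (hermite_series \<alpha> x) \<le> A * series_const * exp (- (1 / 8) * \<mu> \<bar>1 / 4 * x\<bar>)"
proof -
  let ?t = "\<lambda>n. sqrt (exp 1 * (real n + 1)) * exp (- (1 / 2) * \<mu> (sqrt (real n)))"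
  have t: "summable ?t"
    by (rule exp_summable) simp
  have "cmod (hermite_series \<alpha> x) \<le> (\<Sum>n. cmod (\<alpha> n * of_real (hermite_fun n x)))"
    unfolding hermite_series_def by (rule summable_norm[OF hermite_series_summable])
  also have "\<dots> \<le> (\<Sum>n. A * exp (\<bar>D\<bar> / 8) * ?t n * exp (- (1 / 8) * \<mu> \<bar>1 / 4 * x\<bar>))"
    by (intro suminf_le hermite_term_decay[OF \<alpha> A] hermite_series_summable summable_mult summable_mult2 t)
  also have "\<dots> = A * series_const * exp (- (1 / 8) * \<mu> \<bar>1 / 4 * x\<bar>)"
    unfolding series_const_def mult.assoc[symmetric, of A "exp (\<bar>D\<bar> / 8)"]
    by (intro sums_unique[symmetric] sums_mult sums_mult2 summable_sums t)
  finally show ?thesis .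
qed

text \<open>The terms are dominated by a summable sequence in \<open>n\<close> times an integrable
  function of \<open>x\<close>. With \<open>\<phi>\<close> a Hermite function this yields the
  coefficients, with \<open>\<phi>\<close> a character the transform.\<close>

lemma hermite_series_integral:
  assumes [measurable]: "\<phi> \<in> borel_measurable borel" and \<phi>: "\<And>x. cmod (\<phi> x) \<le> B"
  shows "(\<lambda>n. \<alpha> n * (\<integral>x. of_real (hermite_fun n x) * \<phi> x \<partial>lborel)) sums
    (\<integral>x. hermite_series \<alpha> x * \<phi> x \<partial>lborel)"
proof -
  let ?t = "\<lambda>n. sqrt (exp 1 * (real n + 1)) * exp (- (1 / 2) * \<mu> (sqrt (real n)))"
  let ?e = "\<lambda>x. exp (- (1 / 8) * \<mu> \<bar>1 / 4 * x\<bar>)"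
  define f where "f n x = \<alpha> n * of_real (hermite_fun n x) * \<phi> x" for n x
  have t: "summable ?t"
    by (rule exp_summable) simp
  have e: "integrable lborel ?e"
    by (rule exp_integrable) auto
  have B: "0 \<le> B"
    using \<phi>[of 0] norm_ge_zero order_trans by blast
  have bound: "cmod (f n x) \<le> A * exp (\<bar>D\<bar> / 8) * ?t n * ?e x * B" for n x
    unfolding f_def norm_mult[of _ "\<phi> x"]
    by (intro mult_mono hermite_term_decay[OF \<alpha> A] \<phi>) (use A in auto)
  have ei: "integrable lborel (\<lambda>x. A * exp (\<bar>D\<bar> / 8) * ?t n * ?e x * B)" for n
    using e by auto
  have int: "integrable lborel (f n)" for n
  proof (rule Bochner_Integration.integrable_bound[OF ei])
    show "f n \<in> borel_measurable lborel"
      unfolding f_def by simp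
    show "AE x in lborel. norm (f n x) \<le> norm (A * exp (\<bar>D\<bar> / 8) * ?t n * ?e x * B)"
      unfolding real_norm_def by (intro AE_I2 order_trans[OF bound abs_ge_self])
  qed
  have "(\<lambda>n. integral\<^sup>L lborel (f n)) sums (\<integral>x. (\<Sum>n. f n x) \<partial>lborel)"
  proof (rule sums_integral[OF int])
    show "AE x in lborel. summable (\<lambda>n. norm (f n x))"
      unfolding f_def norm_mult[of _ "\<phi> _"]
      by (intro AE_I2 summable_mult2 hermite_series_summable)
    show "summable (\<lambda>n. \<integral>x. norm (f n x) \<partial>lborel)"
    proof (rule summable_comparison_test')
      show "summable (\<lambda>n. A * exp (\<bar>D\<bar> / 8) * ?t n * (integral\<^sup>L lborel ?e * B))"
        by (intro summable_mult summable_mult2 t)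
      fix n
      have "(\<integral>x. norm (f n x) \<partial>lborel) \<le> (\<integral>x. A * exp (\<bar>D\<bar> / 8) * ?t n * ?e x * B \<partial>lborel)"
        by (intro integral_mono bound integrable_norm int ei)
      then show "norm (\<integral>x. norm (f n x) \<partial>lborel) \<le> A * exp (\<bar>D\<bar> / 8) * ?t n * (integral\<^sup>L lborel ?e * B)"
        by (simp add: integral_nonneg_AE mult.assoc)
    qed
  qed
  moreover have "(\<Sum>n. f n x) = hermite_series \<alpha> x * \<phi> x" for x
    unfolding f_def hermite_series_def
    by (rule suminf_mult2[symmetric]) (rule summable_norm_cancel[OF hermite_series_summable])
  moreover have "integral\<^sup>L lborel (f n) = \<alpha> n * (\<integral>x. of_real (hermite_fun n x) * \<phi> x \<partial>lborel)" for n
    by (simp add: f_def[abs_def] mult.assoc)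
  ultimately show ?thesis
    by simp
qed

lemma hermite_series_coeff:
  "(\<integral>x. hermite_series \<alpha> x * of_real (hermite_fun m x) \<partial>lborel) = \<alpha> m"
proof -
  have "(\<lambda>n. \<alpha> n * (if n = m then 1 else 0)) sums
      (\<integral>x. hermite_series \<alpha> x * of_real (hermite_fun m x) \<partial>lborel)"
    using hermite_series_integral[of "\<lambda>x. of_real (hermite_fun m x)" "sqrt (exp 1 * (real m + 1))"] hermite_fun_le
    by (simp add: hermite_fun_orthonormal)
  moreover have "(\<lambda>n. \<alpha> n * (if n = m then 1 else 0)) = (\<lambda>n. if n = m then \<alpha> n else 0)"
    by auto
  ultimately show ?thesis
    using sums_unique2 sums_single by metis
qed

text \<open>Each Hermite function is an eigenfunction. As \<open>(- i) ^ n\<close> has modulus one,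
  the new coefficients obey the same bounds, so \<open>hermite_series_bound\<close> controls the
  transform as well.\<close>

lemma fourier_hermite_series: "fourier (hermite_series \<alpha>) = hermite_series (\<lambda>n. (- \<i>) ^ n * \<alpha> n)"
proof
  fix \<xi>
  have "(\<lambda>n. \<alpha> n * (\<integral>x. of_real (hermite_fun n x) * exp (- \<i> * of_real (\<xi> * x)) \<partial>lborel)) sums
    (\<integral>x. hermite_series \<alpha> x * exp (- \<i> * of_real (\<xi> * x)) \<partial>lborel)"
    by (rule hermite_series_integral[where B = 1])
      (auto intro!: borel_measurable_continuous_onI continuous_intros)
  then have "(\<lambda>n. of_real (1 / sqrt (2 * pi)) *
      (\<alpha> n * (of_real (sqrt (2 * pi)) * ((- \<i>) ^ n * of_real (hermite_fun n \<xi>))))) sums fourier (hermite_series \<alpha>) \<xi>"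
    unfolding fourier_def fourier_hermite_fun by (rule sums_mult)
  moreover have "of_real (1 / sqrt (2 * pi)) *
      (\<alpha> n * (of_real (sqrt (2 * pi)) * ((- \<i>) ^ n * of_real (hermite_fun n \<xi>)))) =
      (- \<i>) ^ n * \<alpha> n * of_real (hermite_fun n \<xi>)" for n
    by simp
  ultimately have "(\<lambda>n. (- \<i>) ^ n * \<alpha> n * of_real (hermite_fun n \<xi>)) sums fourier (hermite_series \<alpha>) \<xi>"
    by (simp only:)
  then show "fourier (hermite_series \<alpha>) \<xi> = hermite_series (\<lambda>n. (- \<i>) ^ n * \<alpha> n) \<xi>"
    unfolding hermite_series_def[of "\<lambda>n. (- \<i>) ^ n * \<alpha> n"] by (rule sums_unique)
qed

end

end

section \<open>Weight functions\<close>

lemma weight_function_mono: "weight_function \<omega> \<Longrightarrow> 0 \<le> s \<Longrightarrow> s \<le> t \<Longrightarrow> \<omega> s \<le> \<omega> t"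
  by (rule mono_onD[of "{0..}" \<omega>]) (simp_all add: weight_function_def)

lemma weight_function_nonneg: "weight_function \<omega> \<Longrightarrow> 0 \<le> t \<Longrightarrow> 0 \<le> \<omega> t"
  by (simp add: weight_function_def)

text \<open>The doubling condition is used twice. It holds for large arguments; for the others
  monotonicity bounds the weight by a constant. \<open>K\<close> is fixed before any multiple of the
  weight is taken, which makes the tameness constant independent of the level.\<close>

lemma weight_function_quarter:
  assumes w: "weight_function \<omega>"
  shows "\<exists>K\<ge>1. \<exists>D. \<forall>t\<ge>0. \<omega> t \<le> K * \<omega> (t / 4) + D"
proof -
  have "(\<lambda>t. \<omega> (2 * t)) \<in> O[at_top](\<omega>)"
    using w by (simp add: weight_function_def)
  then obtain c where c: "eventually (\<lambda>t. norm (\<omega> (2 * t)) \<le> c * norm (\<omega> t)) at_top"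
    by (rule landau_o.bigE)
  then obtain T where T: "\<And>t. T \<le> t \<Longrightarrow> \<bar>\<omega> (2 * t)\<bar> \<le> c * \<bar>\<omega> t\<bar>"
    by (auto simp: eventually_at_top_linorder)
  define K where "K = max 1 c"
  define D where "D = \<omega> (2 * max 0 T)"
  have K: "1 \<le> K" "0 \<le> K"
    by (auto simp: K_def)
  have half: "\<omega> t \<le> K * \<omega> (t / 2) + D" if t: "0 \<le> t" for t
  proof (cases "T \<le> t / 2")
    case True
    have nn: "0 \<le> \<omega> t" "0 \<le> \<omega> (t / 2)" "0 \<le> D"
      using t by (auto simp: D_def intro!: weight_function_nonneg[OF w])
    have "\<omega> t \<le> c * \<omega> (t / 2)"
      using T[OF True] nn by simp
    also have "\<dots> \<le> K * \<omega> (t / 2)"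
      using nn by (intro mult_right_mono) (auto simp: K_def)
    finally show ?thesis
      using nn by simp
  next
    case False
    then have "\<omega> t \<le> D"
      unfolding D_def using t by (intro weight_function_mono[OF w]) auto
    moreover have "0 \<le> K * \<omega> (t / 2)"
      using t K by (intro mult_nonneg_nonneg weight_function_nonneg[OF w]) auto
    ultimately show ?thesis
      by simp
  qed
  have "\<omega> t \<le> K * K * \<omega> (t / 4) + (K * D + D)" if "0 \<le> t" for t
  proof -
    have "K * \<omega> (t / 2) \<le> K * (K * \<omega> (t / 4) + D)"
      using half[of "t / 2"] that K by (intro mult_left_mono) auto
    then show ?thesis
      using half[OF that] by (simp add: algebra_simps)
  qed
  moreover have "1 \<le> K * K"
    using K mult_mono[of 1 K 1 K] by simp
  ultimately show ?thesis
    by blast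
qed

lemma weight_function_le_square:
  assumes w: "weight_function \<omega>" and lim: "Limsup at_top (\<lambda>t. ereal (\<omega> t / t\<^sup>2)) < ereal c"
  shows "\<exists>D. \<forall>t\<ge>0. \<omega> t \<le> c * t\<^sup>2 + D"
proof -
  obtain T where T: "\<And>t. T \<le> t \<Longrightarrow> \<omega> t / t\<^sup>2 < c"
    using Limsup_lessD[OF lim] by (auto simp: eventually_at_top_linorder)
  define S where "S = max 1 T"
  have S: "1 \<le> S" "T \<le> S"
    by (auto simp: S_def)
  \<comment> \<open>Forced by the strict bound at \<open>S\<close>; it allows \<open>c * t^2\<close>
    to be discarded for \<open>t\<close> below \<open>S\<close>.\<close>
  have c: "0 \<le> c"
    using T[OF S(2)] weight_function_nonneg[OF w, of S] S
    by (smt (verit) divide_nonneg_nonneg zero_le_power2)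
  have "\<omega> t \<le> c * t\<^sup>2 + \<omega> S" if t: "0 \<le> t" for t
  proof (cases "S \<le> t")
    case True
    then have "\<omega> t < c * t\<^sup>2"
      using T[of t] S by (simp add: pos_divide_less_eq)
    then show ?thesis
      using weight_function_nonneg[OF w, of S] S by simp
  next
    case False
    then have "\<omega> t \<le> \<omega> S"
      using t by (intro weight_function_mono[OF w]) auto
    then show ?thesis
      using c by (simp add: add_increasing)
  qed
  then show ?thesis
    by blast
qed

text \<open>For large \<open>t\<close>, \<open>ln (1 + t) <= ln 2 + ln t\<close>, and the small-o
  condition with constant \<open>1 / M\<close> bounds \<open>M * ln t\<close> by the weight.\<close>

lemma weight_function_ln_growth:
  assumes w: "weight_function \<omega>"
  shows "\<exists>C. \<forall>t\<ge>0. M * ln (1 + t) \<le> \<omega> t + C"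
proof (cases "0 < M")
  case True
  have "ln \<in> o[at_top](\<omega>)"
    using w by (simp add: weight_function_def)
  then have "eventually (\<lambda>t. norm (ln t) \<le> (1 / M) * norm (\<omega> t)) at_top"
    by (rule landau_o.smallD) (use True in simp)
  then obtain T where T: "\<And>t. T \<le> t \<Longrightarrow> \<bar>ln t\<bar> \<le> (1 / M) * \<bar>\<omega> t\<bar>"
    by (auto simp: eventually_at_top_linorder)
  define S where "S = max 1 T"
  have S: "1 \<le> S" "T \<le> S"
    by (auto simp: S_def)
  have "M * ln (1 + t) \<le> \<omega> t + (M * ln 2 + M * ln (1 + S))" if t: "0 \<le> t" for t
  proof (cases "S \<le> t")
    case True': True
    have "ln (1 + t) \<le> ln (2 * t)"
      using True' S by simp
    also have "\<dots> = ln 2 + ln t"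
      using True' S by (simp add: ln_mult)
    finally have "M * ln (1 + t) \<le> M * (ln 2 + ln t)"
      using True by simp
    moreover have "ln t \<le> (1 / M) * \<omega> t"
      using T[of t] True' S weight_function_nonneg[OF w t] by simp
    then have "M * ln t \<le> \<omega> t"
      using True by (simp add: field_simps)
    moreover have "0 \<le> M * ln (1 + S)"
      using True S by simp
    ultimately show ?thesis
      by (simp add: algebra_simps)
  next
    case False
    then have "M * ln (1 + t) \<le> M * ln (1 + S)"
      using True t by simp
    moreover have "0 \<le> M * ln 2"
      using True by simp
    ultimately show ?thesis
      using weight_function_nonneg[OF w t] by simp
  qed
  then show ?thesis
    by blast
next
  case False
  have "M * ln (1 + t) \<le> \<omega> t + 0" if t: "0 \<le> t" for t
    using weight_function_nonneg[OF w t] mult_nonpos_nonneg[of M "ln (1 + t)"] False t by simp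
  then show ?thesis
    by blast
qed

lemma subquadratic_weightI:
  assumes w: "weight_function \<omega>" and l: "0 < l" and D: "\<And>t. 0 \<le> t \<Longrightarrow> l * \<omega> t \<le> t\<^sup>2 + D"
  shows "subquadratic_weight (\<lambda>t. l * \<omega> t) D"
proof
  fix M
  obtain C where C: "\<And>t. 0 \<le> t \<Longrightarrow> (M / l) * ln (1 + t) \<le> \<omega> t + C"
    using weight_function_ln_growth[OF w, of "M / l"] by blast
  have "M * ln (1 + t) \<le> l * \<omega> t + l * C" if "0 \<le> t" for t
  proof -
    have "l * ((M / l) * ln (1 + t)) \<le> l * (\<omega> t + C)"
      using C[OF that] l by (intro mult_left_mono) auto
    then show ?thesis
      using l by (simp add: algebra_simps)
  qed
  then show "\<exists>C. \<forall>t\<ge>0. M * ln (1 + t) \<le> l * \<omega> t + C"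
    by blast
qed (use l in \<open>auto intro: D mult_nonneg_nonneg mult_left_mono weight_function_mono[OF w] weight_function_nonneg[OF w]\<close>)

lemma weight_function_measurable:
  assumes w: "weight_function \<omega>"
  shows "(\<lambda>x. \<omega> \<bar>x\<bar>) \<in> borel_measurable borel"
proof -
  have "continuous_on UNIV (\<lambda>x. \<omega> \<bar>x\<bar>)"
  proof (rule continuous_on_compose2[of "{0..}" \<omega> UNIV abs])
    show "continuous_on {0..} \<omega>"
      using w by (simp add: weight_function_def)
    show "continuous_on UNIV (\<lambda>x::real. \<bar>x\<bar>)"
      by (intro continuous_intros)
  qed auto
  then show ?thesis
    by (rule borel_measurable_continuous_onI)
qed

section \<open>The Hermite coefficient map on \<open>L\<^sup>2(\<real>)\<close>\<close>

lemma l2_cases: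
  fixes f :: l2
  obtains g where "square_integrable g" "f = abs_l2 g"
proof -
  have "\<exists>g. square_integrable g \<and> f = abs_l2 g"
    by (induction f rule: l2.abs_induct) (auto simp: l2_rel_def)
  then show thesis
    using that by blast
qed

lemma l2_rel_refl: "square_integrable g \<Longrightarrow> l2_rel g g"
  by (simp add: l2_rel_def)

lemma hermite_coeffs_abs_l2:
  assumes "square_integrable g"
  shows "hermite_coeffs (abs_l2 g) n = (\<integral>x. g x * of_real (hermite_fun n x) \<partial>lborel)"
  unfolding hermite_coeffs_def hermite_l2.abs_eq
  by (subst l2_inner.abs_eq) (auto simp: l2_rel_refl assms square_integrable_hermite)

lemma l2_fourier_abs_l2:
  assumes "square_integrable g"
  shows "l2_fourier (abs_l2 g) = fourier g"
  by (simp add: l2_fourier.abs_eq l2_rel_refl assms fourier_def fun_eq_iff)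

lemma hermite_coeffs_add: "hermite_coeffs (f + g) = hermite_coeffs f + hermite_coeffs g"
proof -
  obtain f' g' where f: "square_integrable f'" "f = abs_l2 f'" and g: "square_integrable g'" "g = abs_l2 g'"
    using l2_cases by metis
  have "hermite_coeffs (f + g) n = hermite_coeffs f n + hermite_coeffs g n" for n
    using gauss_integrable_hermite(1)[OF gauss_integrable_square_integrable[OF f(1)], of n]
      gauss_integrable_hermite(1)[OF gauss_integrable_square_integrable[OF g(1)], of n]
    by (simp add: f g plus_l2.abs_eq l2_rel_refl hermite_coeffs_abs_l2 square_integrable_add distrib_right)
  then show ?thesis
    by (simp add: fun_eq_iff)
qed

lemma hermite_coeffs_cscale: "hermite_coeffs (cscale c f) = cscale c (hermite_coeffs f)"
proof -
  obtain f' where f: "square_integrable f'" "f = abs_l2 f'"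
    by (rule l2_cases)
  have "hermite_coeffs (cscale c f) n = c * hermite_coeffs f n" for n
    by (simp add: f cscale_l2.abs_eq l2_rel_refl hermite_coeffs_abs_l2 square_integrable_scale mult.assoc)
  then show ?thesis
    by (simp add: fun_eq_iff cscale_fun_def cscale_complex_def)
qed

text \<open>A difference with vanishing coefficients has a \<open>gauss_integrable\<close>
  representative, so \<open>hermite_complete\<close> applies. Injectivity on all of
  \<open>l2\<close> later identifies the inverse map and gives its linearity without computing with
  series.\<close>

lemma inj_hermite_coeffs: "inj hermite_coeffs"
proof (rule injI)
  fix f g assume eq: "hermite_coeffs f = hermite_coeffs g"
  have diff: "hermite_coeffs (f + cscale (- 1) g) n = 0" for n
    unfolding hermite_coeffs_add hermite_coeffs_cscale eq by (simp add: cscale_fun_def cscale_complex_def)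
  obtain f' g' where f: "square_integrable f'" "f = abs_l2 f'" and g: "square_integrable g'" "g = abs_l2 g'"
    using l2_cases by metis
  define h where "h x = f' x + (- 1) * g' x" for x
  have h: "square_integrable h"
    unfolding h_def[abs_def] by (intro square_integrable_add square_integrable_scale f g)
  have "f + cscale (- 1) g = abs_l2 h"
    unfolding f g h_def[abs_def]
    by (simp add: plus_l2.abs_eq cscale_l2.abs_eq l2_rel_refl f g square_integrable_scale[OF g(1), of "- 1", simplified])
  with diff have "(\<integral>x. h x * of_real (hermite_fun n x) \<partial>lborel) = 0" for n
    by (simp add: hermite_coeffs_abs_l2 h)
  then have "AE x in lborel. h x = 0"
    by (rule hermite_complete[OF gauss_integrable_square_integrable[OF h]])
  then have "AE x in lborel. f' x = g' x"
    by eventually_elim (simp add: h_def)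
  then have "l2_rel f' g'"
    by (simp add: l2_rel_def f g)
  then show "f = g"
    unfolding f g by (rule Quotient_rel_abs[OF Quotient_l2])
qed

section \<open>Norms as bounds for representatives and coefficients\<close>

lemma S_step_iff:
  assumes g: "square_integrable g"
  shows "abs_l2 g \<in> S_step \<omega> l \<longleftrightarrow>
    (\<exists>C. AE x in lborel. cmod (g x) \<le> C * exp (- l * \<omega> \<bar>x\<bar>)) \<and>
    (\<exists>C. \<forall>\<xi>. cmod (fourier g \<xi>) \<le> C * exp (- l * \<omega> \<bar>\<xi>\<bar>))"
  by (simp add: S_step_def l2_ae_bounded.abs_eq l2_rel_refl l2_fourier_abs_l2 g)

lemma le_exp_minus_iff: "a \<le> C * exp (- l * w) \<longleftrightarrow> a * exp (l * w) \<le> (C :: real)"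
proof -
  have "exp (- l * w) = inverse (exp (l * w))"
    by (simp flip: exp_minus)
  then show ?thesis
    by (simp add: pos_le_divide_eq flip: divide_inverse)
qed

text \<open>\<open>S_norm\<close> is built from \<open>real_of_ereal\<close> and a real supremum,
  which need finiteness to be meaningful. Membership in the step provides it; the norm is then a
  valid constant in both bounds and at most the sum of any two such constants.\<close>

lemma S_norm_bounds:
  assumes w: "weight_function \<omega>" and g: "square_integrable g" and S: "abs_l2 g \<in> S_step \<omega> l"
  shows "0 \<le> S_norm \<omega> l (abs_l2 g)"
    and "AE x in lborel. cmod (g x) \<le> S_norm \<omega> l (abs_l2 g) * exp (- l * \<omega> \<bar>x\<bar>)"
    and "cmod (fourier g \<xi>) \<le> S_norm \<omega> l (abs_l2 g) * exp (- l * \<omega> \<bar>\<xi>\<bar>)"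
    and "\<And>A B. AE x in lborel. cmod (g x) \<le> A * exp (- l * \<omega> \<bar>x\<bar>) \<Longrightarrow>
      (\<And>\<xi>. cmod (fourier g \<xi>) \<le> B * exp (- l * \<omega> \<bar>\<xi>\<bar>)) \<Longrightarrow> S_norm \<omega> l (abs_l2 g) \<le> A + B"
proof -
  let ?F = "\<lambda>x. ereal (cmod (g x * complex_of_real (exp (l * \<omega> \<bar>x\<bar>))))"
  let ?G = "\<lambda>\<xi>. cmod (fourier g \<xi>) * exp (l * \<omega> \<bar>\<xi>\<bar>)"
  define E where "E = esssup lebesgue ?F"
  have [measurable]: "(\<lambda>x. \<omega> \<bar>x\<bar>) \<in> borel_measurable borel" "g \<in> borel_measurable borel"
    using weight_function_measurable[OF w] g by (auto simp: square_integrable_def)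
  \<comment> \<open>\<open>esssup\<close> has a default value on functions that are not measurable,
    so measurability for \<open>lebesgue\<close> comes first.\<close>
  have "?F \<in> borel_measurable lborel"
    by measurable
  then have meas: "?F \<in> borel_measurable lebesgue"
    by (rule measurable_completion)
  have E_le: "E \<le> ereal A" if "AE x in lborel. cmod (g x) \<le> A * exp (- l * \<omega> \<bar>x\<bar>)" for A
  proof -
    have "AE x in lborel. ?F x \<le> ereal A"
      using that by eventually_elim (simp add: norm_mult le_exp_minus_iff[simplified])
    then show ?thesis
      unfolding E_def by (intro esssup_I meas AE_completion)
  qed
  have "esssup lebesgue (\<lambda>x::real. 0 :: ereal) \<le> E"
    unfolding E_def by (intro esssup_mono meas) auto
  then have "0 \<le> E"
    by (subst (asm) esssup_const) auto
  moreover from S obtain A where "AE x in lborel. cmod (g x) \<le> A * exp (- l * \<omega> \<bar>x\<bar>)"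
    unfolding S_step_iff[OF g] by blast
  then have "E \<le> ereal A"
    by (rule E_le)
  \<comment> \<open>As \<open>E\<close> is finite, \<open>real_of_ereal\<close> returns the true
    essential supremum.\<close>
  ultimately obtain a where a: "E = ereal a" "0 \<le> a"
    by (cases E) auto
  from S obtain B where "\<And>\<xi>. cmod (fourier g \<xi>) \<le> B * exp (- l * \<omega> \<bar>\<xi>\<bar>)"
    unfolding S_step_iff[OF g] by blast
  then have bdd: "bdd_above (range ?G)"
    by (intro bdd_aboveI[of _ B]) (auto simp: le_exp_minus_iff[simplified])
  define b where "b = (SUP \<xi>. ?G \<xi>)"
  have b: "?G \<xi> \<le> b" for \<xi>
    unfolding b_def by (rule cSUP_upper[OF _ bdd]) simp
  have "0 \<le> ?G 0"
    by simp
  then have b0: "0 \<le> b"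
    using b[of 0] by linarith
  have norm: "S_norm \<omega> l (abs_l2 g) = a + b"
    using a(1) unfolding S_norm_def l2_fourier_abs_l2[OF g] b_def E_def
    by (simp add: l2_weighted_esssup.abs_eq l2_rel_refl g)
  show "0 \<le> S_norm \<omega> l (abs_l2 g)"
    using norm a b0 by simp
  have "AE x in lebesgue. ?F x \<le> E"
    unfolding E_def by (rule esssup_AE)
  then have "AE x in lborel. ?F x \<le> E"
    by (simp only: AE_completion_iff)
  then show "AE x in lborel. cmod (g x) \<le> S_norm \<omega> l (abs_l2 g) * exp (- l * \<omega> \<bar>x\<bar>)"
  proof eventually_elim
    fix x assume "?F x \<le> E"
    then have "cmod (g x) * exp (l * \<omega> \<bar>x\<bar>) \<le> a + b"
      using b0 by (simp add: a norm_mult)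
    then show "cmod (g x) \<le> S_norm \<omega> l (abs_l2 g) * exp (- l * \<omega> \<bar>x\<bar>)"
      unfolding le_exp_minus_iff norm .
  qed
  show "cmod (fourier g \<xi>) \<le> S_norm \<omega> l (abs_l2 g) * exp (- l * \<omega> \<bar>\<xi>\<bar>)"
    unfolding le_exp_minus_iff norm using b[of \<xi>] a(2) by simp
  fix A B
  assume A: "AE x in lborel. cmod (g x) \<le> A * exp (- l * \<omega> \<bar>x\<bar>)"
    and B: "\<And>\<xi>. cmod (fourier g \<xi>) \<le> B * exp (- l * \<omega> \<bar>\<xi>\<bar>)"
  have "b \<le> B"
    unfolding b_def by (intro cSUP_least) (use B in \<open>auto simp: le_exp_minus_iff[simplified]\<close>)
  then show "S_norm \<omega> l (abs_l2 g) \<le> A + B"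
    using E_le[OF A] a norm by simp
qed

lemma Lambda_norm_bounds:
  assumes \<alpha>: "\<alpha> \<in> Lambda_step \<omega> l"
  shows "0 \<le> Lambda_norm \<omega> l \<alpha>"
    and "cmod (\<alpha> n) \<le> Lambda_norm \<omega> l \<alpha> * exp (- l * \<omega> (sqrt (real n)))"
proof -
  let ?G = "\<lambda>n. cmod (\<alpha> n) * exp (l * \<omega> (sqrt (real n)))"
  from \<alpha> obtain A where "\<And>n. cmod (\<alpha> n) \<le> A * exp (- l * \<omega> (sqrt (real n)))"
    unfolding Lambda_step_def by blast
  then have bdd: "bdd_above (range ?G)"
    by (intro bdd_aboveI[of _ A]) (auto simp: le_exp_minus_iff[simplified])
  have b: "?G n \<le> Lambda_norm \<omega> l \<alpha>" for n
    unfolding Lambda_norm_def by (rule cSUP_upper[OF _ bdd]) simp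
  then show "cmod (\<alpha> n) \<le> Lambda_norm \<omega> l \<alpha> * exp (- l * \<omega> (sqrt (real n)))"
    unfolding le_exp_minus_iff .
  have "0 \<le> ?G 0"
    by simp
  then show "0 \<le> Lambda_norm \<omega> l \<alpha>"
    using b[of 0] by linarith
qed

lemma Lambda_norm_le:
  assumes "\<And>n. cmod (\<alpha> n) \<le> A * exp (- l * \<omega> (sqrt (real n)))"
  shows "\<alpha> \<in> Lambda_step \<omega> l" "Lambda_norm \<omega> l \<alpha> \<le> A"
proof -
  show "\<alpha> \<in> Lambda_step \<omega> l"
    using assms unfolding Lambda_step_def by blast
  show "Lambda_norm \<omega> l \<alpha> \<le> A"
    unfolding Lambda_norm_def by (intro cSUP_least) (use assms in \<open>auto simp: le_exp_minus_iff[simplified]\<close>)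
qed

section \<open>Estimates between the steps of the two scales\<close>

text \<open>\<open>abs_l2\<close> is meaningful on square integrable functions; for sequences in a
  step this is established within \<open>hermite_synthesis_estimate\<close>.\<close>

definition hermite_synthesis :: "(nat \<Rightarrow> complex) \<Rightarrow> l2" where
  "hermite_synthesis \<alpha> = abs_l2 (hermite_series \<alpha>)"

text \<open>\<open>p\<close> is the tameness constant in both directions.\<close>

locale quartered_weight =
  fixes \<omega> :: "real \<Rightarrow> real" and K D :: real and p :: nat
  assumes weight: "weight_function \<omega>" and K: "1 \<le> K" "8 * K \<le> real p"
    and quarter: "0 \<le> t \<Longrightarrow> \<omega> t \<le> K * \<omega> (t / 4) + D"
begin

text \<open>Undoing the dilation by 4 divides the exponent by \<open>K\<close>; the additive
  constant \<open>D\<close> enters only through a factor depending on \<open>l\<close>.\<close>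

lemma quarter_exp:
  assumes l: "0 < l" and t: "0 \<le> t"
  shows "exp (- (1 / 8) * (l * \<omega> (t / 4))) \<le> exp (l * \<bar>D\<bar>) * exp (- (l / (8 * K)) * \<omega> t)"
proof -
  have "\<omega> t / K \<le> \<omega> (t / 4) + D / K"
    using quarter[OF t] K by (simp add: field_simps)
  moreover have "D / K \<le> \<bar>D\<bar> / 1"
    using K by (intro frac_le) auto
  ultimately have "l / 8 * (\<omega> t / K) \<le> l / 8 * (\<omega> (t / 4) + \<bar>D\<bar>)"
    using l by (intro mult_left_mono) auto
  moreover have "0 \<le> l * \<bar>D\<bar>"
    using l by simp
  ultimately have "- (1 / 8) * (l * \<omega> (t / 4)) \<le> l * \<bar>D\<bar> + - (l / (8 * K)) * \<omega> t"
    by (simp add: field_simps)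
  then show ?thesis
    by (simp flip: exp_add)
qed

text \<open>Passes from the real number \<open>8 * K\<close> to the natural number \<open>p\<close>,
  since the tameness constant multiplies the index of a step.\<close>

lemma exp_divide_le:
  assumes "0 < l" "0 \<le> t"
  shows "exp (- (l / (8 * K)) * \<omega> t) \<le> exp (- (l / real p) * \<omega> t)"
proof -
  have "l / real p \<le> l / (8 * K)"
    using assms K by (intro divide_left_mono) auto
  then have "l / real p * \<omega> t \<le> l / (8 * K) * \<omega> t"
    by (intro mult_right_mono weight_function_nonneg[OF weight assms(2)])
  then show ?thesis
    by simp
qed

text \<open>The exponent with divisor 4 is split into two with divisor 8. After
  \<open>quarter_exp\<close> one of them absorbs the factor \<open>s n\<close> through the constant
  \<open>T\<close>, the other is the claimed decay.\<close>

lemma hermite_coeffs_estimate: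
  assumes l: "0 < l" and D': "\<And>t. 0 \<le> t \<Longrightarrow> l * \<omega> t \<le> t\<^sup>2 + D'"
  shows "\<exists>C. \<forall>f\<in>S_step \<omega> l. hermite_coeffs f \<in> Lambda_step \<omega> (l / real p) \<and>
    Lambda_norm \<omega> (l / real p) (hermite_coeffs f) \<le> C * S_norm \<omega> l f"
proof -
  interpret subquadratic_weight "\<lambda>t. l * \<omega> t" D'
    by (rule subquadratic_weightI[OF weight l D'])
  define c where "c = 1 / (8 * K)"
  have c: "0 < c" "l / (8 * K) = l * c"
    using K by (auto simp: c_def)
  define s where "s n = sqrt (exp 1 * (real n + 1))" for n
  \<comment> \<open>The sum of nonnegative terms, used only as a bound for each of them.\<close>
  define T where "T = (\<Sum>n. s n * exp (- c * (l * \<omega> (sqrt (real n)))))"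
  have T: "s n * exp (- c * (l * \<omega> (sqrt (real n)))) \<le> T" for n
    using sum_le_suminf[OF exp_summable[OF c(1)], of "{n}"] by (simp add: T_def s_def)
  have T0: "0 \<le> T"
    by (rule order_trans[OF _ T[of 0]]) (simp add: s_def)
  have key: "s n * exp (- (l * \<omega> (sqrt (real n) / 2)) / 4) \<le>
      exp (l * \<bar>D\<bar>) * exp (l * \<bar>D\<bar>) * T * exp (- (l / real p) * \<omega> (sqrt (real n)))" for n
  proof -
    let ?t = "sqrt (real n)"
    let ?e = "exp (- (l / (8 * K)) * \<omega> ?t)"
    have "\<omega> (?t / 4) \<le> \<omega> (?t / 2)"
      by (rule weight_function_mono[OF weight]) auto
    then have "l * \<omega> (?t / 4) \<le> l * \<omega> (?t / 2)"
      using l by simp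
    then have "exp (- (l * \<omega> (?t / 2)) / 4) \<le>
        exp (- (1 / 8) * (l * \<omega> (?t / 4))) * exp (- (1 / 8) * (l * \<omega> (?t / 4)))"
      by (simp flip: exp_add)
    also have "\<dots> \<le> (exp (l * \<bar>D\<bar>) * ?e) * (exp (l * \<bar>D\<bar>) * ?e)"
      by (intro mult_mono quarter_exp l) auto
    finally have "s n * exp (- (l * \<omega> (?t / 2)) / 4) \<le> s n * ((exp (l * \<bar>D\<bar>) * ?e) * (exp (l * \<bar>D\<bar>) * ?e))"
      by (intro mult_left_mono) (auto simp: s_def)
    also have "\<dots> = exp (l * \<bar>D\<bar>) * exp (l * \<bar>D\<bar>) * (s n * ?e) * ?e"
      by (simp only: mult_ac)
    also have "\<dots> \<le> exp (l * \<bar>D\<bar>) * exp (l * \<bar>D\<bar>) * T * exp (- (l / real p) * \<omega> ?t)"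
    proof (intro mult_mono order_refl)
      show "s n * ?e \<le> T"
        using T[of n] unfolding c(2) by (simp add: mult_ac)
      show "0 \<le> exp (l * \<bar>D\<bar>) * exp (l * \<bar>D\<bar>) * T"
        using T0 by simp
      show "?e \<le> exp (- (l / real p) * \<omega> ?t)"
        using exp_divide_le[OF l, of ?t] by simp
    qed (auto simp: s_def)
    finally show ?thesis .
  qed
  have c0: "0 \<le> coeff_const"
    by (simp add: coeff_const_def integral_nonneg_AE)
  have "hermite_coeffs f \<in> Lambda_step \<omega> (l / real p) \<and>
      Lambda_norm \<omega> (l / real p) (hermite_coeffs f) \<le>
      coeff_const * (exp (l * \<bar>D\<bar>) * exp (l * \<bar>D\<bar>) * T) * S_norm \<omega> l f" if f: "f \<in> S_step \<omega> l" for f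
  proof -
    obtain g where g: "square_integrable g" "f = abs_l2 g"
      by (rule l2_cases)
    define A where "A = S_norm \<omega> l f"
    have gS: "abs_l2 g \<in> S_step \<omega> l"
      using f g by simp
    note bounds = S_norm_bounds(1-3)[OF weight g(1) gS, folded g(2), folded A_def]
    have "cmod (hermite_coeffs f n) \<le>
        coeff_const * (exp (l * \<bar>D\<bar>) * exp (l * \<bar>D\<bar>) * T) * A * exp (- (l / real p) * \<omega> (sqrt (real n)))" for n
    proof -
      have "cmod (hermite_coeffs f n) \<le> s n * (A * coeff_const * exp (- (l * \<omega> (sqrt (real n) / 2)) / 4))"
        unfolding g(2) hermite_coeffs_abs_l2[OF g(1)] s_def
        by (rule hermite_coeff_decay) (use bounds g in \<open>auto simp: square_integrable_def\<close>)
      also have "\<dots> = A * coeff_const * (s n * exp (- (l * \<omega> (sqrt (real n) / 2)) / 4))"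
        by (simp only: mult_ac)
      also have "\<dots> \<le> A * coeff_const *
          (exp (l * \<bar>D\<bar>) * exp (l * \<bar>D\<bar>) * T * exp (- (l / real p) * \<omega> (sqrt (real n))))"
        by (intro mult_left_mono key) (use c0 bounds in auto)
      finally show ?thesis
        by (simp only: mult_ac)
    qed
    from Lambda_norm_le[where \<alpha> = "hermite_coeffs f" and \<omega> = \<omega> and l = "l / real p", OF this] show ?thesis
      by (simp add: A_def)
  qed
  then show ?thesis
    by blast
qed

text \<open>The local fact \<open>series\<close> is used twice, for \<open>\<alpha> n\<close> and
  for the coefficients \<open>(- i) ^ n * \<alpha> n\<close> of the transform; the norm adds the two
  bounds, hence the factor 2.\<close>

lemma hermite_synthesis_estimate:
  assumes l: "0 < l" and D': "\<And>t. 0 \<le> t \<Longrightarrow> l * \<omega> t \<le> t\<^sup>2 + D'"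
  shows "\<exists>C. \<forall>\<alpha>\<in>Lambda_step \<omega> l. hermite_synthesis \<alpha> \<in> S_step \<omega> (l / real p) \<and>
    hermite_coeffs (hermite_synthesis \<alpha>) = \<alpha> \<and>
    S_norm \<omega> (l / real p) (hermite_synthesis \<alpha>) \<le> C * Lambda_norm \<omega> l \<alpha>"
proof -
  interpret subquadratic_weight "\<lambda>t. l * \<omega> t" D'
    by (rule subquadratic_weightI[OF weight l D'])
  let ?C = "series_const * exp (l * \<bar>D\<bar>)"
  have "0 \<le> (\<Sum>n. sqrt (exp 1 * (real n + 1)) * exp (- (1 / 2) * (l * \<omega> (sqrt (real n)))))"
    by (intro suminf_nonneg exp_summable) auto
  then have s0: "0 \<le> series_const"
    by (simp add: series_const_def)
  have series: "cmod (hermite_series \<beta> x) \<le> A * ?C * exp (- (l / real p) * \<omega> \<bar>x\<bar>)"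
    if \<beta>: "\<And>n. cmod (\<beta> n) \<le> A * exp (- (l * \<omega> (sqrt (real n))))" and A: "0 \<le> A" for \<beta> A x
  proof -
    have "cmod (hermite_series \<beta> x) \<le> A * series_const * exp (- (1 / 8) * (l * \<omega> \<bar>1 / 4 * x\<bar>))"
      by (rule hermite_series_bound[OF \<beta> A])
    also have "\<dots> \<le> A * series_const * (exp (l * \<bar>D\<bar>) * exp (- (l / real p) * \<omega> \<bar>x\<bar>))"
    proof (intro mult_left_mono)
      have "exp (- (1 / 8) * (l * \<omega> (\<bar>x\<bar> / 4))) \<le> exp (l * \<bar>D\<bar>) * exp (- (l / (8 * K)) * \<omega> \<bar>x\<bar>)"
        by (rule quarter_exp[OF l]) simp
      also have "\<dots> \<le> exp (l * \<bar>D\<bar>) * exp (- (l / real p) * \<omega> \<bar>x\<bar>)"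
        by (intro mult_left_mono exp_divide_le l) auto
      finally show "exp (- (1 / 8) * (l * \<omega> \<bar>1 / 4 * x\<bar>)) \<le> exp (l * \<bar>D\<bar>) * exp (- (l / real p) * \<omega> \<bar>x\<bar>)"
        by (simp add: abs_mult)
    qed (use s0 A in simp)
    finally show ?thesis
      by (simp only: mult.assoc)
  qed
  have "hermite_synthesis \<alpha> \<in> S_step \<omega> (l / real p) \<and> hermite_coeffs (hermite_synthesis \<alpha>) = \<alpha> \<and>
    S_norm \<omega> (l / real p) (hermite_synthesis \<alpha>) \<le> 2 * ?C * Lambda_norm \<omega> l \<alpha>"
    if \<alpha>: "\<alpha> \<in> Lambda_step \<omega> l" for \<alpha>
  proof -
    define A where "A = Lambda_norm \<omega> l \<alpha>"
    have A: "0 \<le> A" and \<alpha>A: "cmod (\<alpha> n) \<le> A * exp (- (l * \<omega> (sqrt (real n))))" for n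
      using Lambda_norm_bounds[OF \<alpha>] by (auto simp: A_def)
    have \<alpha>A': "cmod ((- \<i>) ^ n * \<alpha> n) \<le> A * exp (- (l * \<omega> (sqrt (real n))))" for n
      using \<alpha>A[of n] by (simp add: norm_mult norm_power)
    have meas [measurable]: "hermite_series \<alpha> \<in> borel_measurable borel"
      by (rule hermite_series_measurable[OF \<alpha>A A])
    have f: "square_integrable (hermite_series \<alpha>)"
      unfolding square_integrable_def
    proof
      have "integrable lborel (\<lambda>x. (A * series_const)\<^sup>2 * exp (- (1 / 4) * (l * \<omega> \<bar>1 / 4 * x\<bar>)))"
        by (intro integrable_mult_right exp_integrable) auto
      then show "integrable lborel (\<lambda>x. (cmod (hermite_series \<alpha> x))\<^sup>2)"
      proof (rule Bochner_Integration.integrable_bound)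
        show "AE x in lborel. norm ((cmod (hermite_series \<alpha> x))\<^sup>2) \<le>
            norm ((A * series_const)\<^sup>2 * exp (- (1 / 4) * (l * \<omega> \<bar>1 / 4 * x\<bar>)))"
        proof (rule AE_I2)
          fix x
          have "(cmod (hermite_series \<alpha> x))\<^sup>2 \<le> (A * series_const * exp (- (1 / 8) * (l * \<omega> \<bar>1 / 4 * x\<bar>)))\<^sup>2"
            by (intro power_mono hermite_series_bound[OF \<alpha>A A]) auto
          also have "\<dots> = (A * series_const)\<^sup>2 * exp (- (1 / 4) * (l * \<omega> \<bar>1 / 4 * x\<bar>))"
            by (simp add: power_mult_distrib flip: exp_of_nat_mult)
          finally show "norm ((cmod (hermite_series \<alpha> x))\<^sup>2) \<le>
              norm ((A * series_const)\<^sup>2 * exp (- (1 / 4) * (l * \<omega> \<bar>1 / 4 * x\<bar>)))"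
            by simp
        qed
      qed simp
    qed simp
    have b1: "cmod (hermite_series \<alpha> x) \<le> A * ?C * exp (- (l / real p) * \<omega> \<bar>x\<bar>)" for x
      by (rule series[OF \<alpha>A A])
    have b2: "cmod (fourier (hermite_series \<alpha>) \<xi>) \<le> A * ?C * exp (- (l / real p) * \<omega> \<bar>\<xi>\<bar>)" for \<xi>
      unfolding fourier_hermite_series[OF \<alpha>A A] by (rule series[OF \<alpha>A' A])
    have S: "abs_l2 (hermite_series \<alpha>) \<in> S_step \<omega> (l / real p)"
      unfolding S_step_iff[OF f] using b1 b2 by blast
    have "S_norm \<omega> (l / real p) (abs_l2 (hermite_series \<alpha>)) \<le> A * ?C + A * ?C"
      by (rule S_norm_bounds(4)[OF weight f S AE_I2[OF b1] b2])
    moreover have "hermite_coeffs (abs_l2 (hermite_series \<alpha>)) = \<alpha>"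
      by (simp add: fun_eq_iff hermite_coeffs_abs_l2 f hermite_series_coeff[OF \<alpha>A A])
    ultimately show ?thesis
      using S by (simp add: hermite_synthesis_def A_def algebra_simps)
  qed
  then show ?thesis
    by blast
qed

end

section \<open>The tame isomorphisms\<close>

lemma Lambda_step_add:
  assumes "\<alpha> \<in> Lambda_step \<omega> l" "\<beta> \<in> Lambda_step \<omega> l"
  shows "\<alpha> + \<beta> \<in> Lambda_step \<omega> l"
proof -
  from assms obtain A B where "\<And>n. cmod (\<alpha> n) \<le> A * exp (- l * \<omega> (sqrt (real n)))"
    "\<And>n. cmod (\<beta> n) \<le> B * exp (- l * \<omega> (sqrt (real n)))"
    unfolding Lambda_step_def by blast
  then have "cmod ((\<alpha> + \<beta>) n) \<le> (A + B) * exp (- l * \<omega> (sqrt (real n)))" for n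
    unfolding plus_fun_apply distrib_right by (rule norm_triangle_mono)
  then show ?thesis
    by (rule Lambda_norm_le)
qed

lemma Lambda_step_cscale:
  assumes "\<alpha> \<in> Lambda_step \<omega> l"
  shows "cscale c \<alpha> \<in> Lambda_step \<omega> l"
proof -
  from assms obtain A where "\<And>n. cmod (\<alpha> n) \<le> A * exp (- l * \<omega> (sqrt (real n)))"
    unfolding Lambda_step_def by blast
  then have "cmod (cscale c \<alpha> n) \<le> (cmod c * A) * exp (- l * \<omega> (sqrt (real n)))" for n
    by (simp add: cscale_fun_def cscale_complex_def norm_mult mult.assoc mult_left_mono)
  then show ?thesis
    by (rule Lambda_norm_le)
qed

lemma Lambda_inductive_closed:
  assumes w: "weight_function \<omega>"
  shows "\<alpha> \<in> Lambda_inductive \<omega> \<Longrightarrow> \<beta> \<in> Lambda_inductive \<omega> \<Longrightarrow> \<alpha> + \<beta> \<in> Lambda_inductive \<omega>"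
    and "\<alpha> \<in> Lambda_inductive \<omega> \<Longrightarrow> cscale c \<alpha> \<in> Lambda_inductive \<omega>"
proof -
  assume "\<alpha> \<in> Lambda_inductive \<omega>" "\<beta> \<in> Lambda_inductive \<omega>"
  then obtain k l where kl: "0 < k" "\<alpha> \<in> Lambda_step \<omega> k" "0 < l" "\<beta> \<in> Lambda_step \<omega> l"
    by (auto simp: Lambda_inductive_def)
  then have "\<alpha> \<in> Lambda_step \<omega> (min k l)" "\<beta> \<in> Lambda_step \<omega> (min k l)"
    using Lambda_step_antimono[OF w, of "min k l" k] Lambda_step_antimono[OF w, of "min k l" l] by auto
  then have "\<alpha> + \<beta> \<in> Lambda_step \<omega> (min k l)"
    by (rule Lambda_step_add)
  moreover have "0 < min k l"
    using kl by simp
  ultimately show "\<alpha> + \<beta> \<in> Lambda_inductive \<omega>"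
    unfolding Lambda_inductive_def by blast
next
  assume "\<alpha> \<in> Lambda_inductive \<omega>"
  then show "cscale c \<alpha> \<in> Lambda_inductive \<omega>"
    unfolding Lambda_inductive_def by (blast intro: Lambda_step_cscale)
qed

lemma Lambda_projective_closed:
  shows "\<alpha> \<in> Lambda_projective \<omega> \<Longrightarrow> \<beta> \<in> Lambda_projective \<omega> \<Longrightarrow> \<alpha> + \<beta> \<in> Lambda_projective \<omega>"
    and "\<alpha> \<in> Lambda_projective \<omega> \<Longrightarrow> cscale c \<alpha> \<in> Lambda_projective \<omega>"
  unfolding Lambda_projective_def by (simp_all add: Lambda_step_add Lambda_step_cscale)

text \<open>The algebra common to both kinds of space. Linearity of the inverse follows from
  injectivity on \<open>l2\<close>, as both sides of each identity have the same
  coefficients.\<close>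

lemma hermite_coeffs_linear_bijection:
  assumes E: "\<And>f. f \<in> E \<Longrightarrow> hermite_coeffs f \<in> F"
    and F: "\<And>\<alpha>. \<alpha> \<in> F \<Longrightarrow> hermite_synthesis \<alpha> \<in> E \<and> hermite_coeffs (hermite_synthesis \<alpha>) = \<alpha>"
    and add: "\<And>\<alpha> \<beta>. \<alpha> \<in> F \<Longrightarrow> \<beta> \<in> F \<Longrightarrow> \<alpha> + \<beta> \<in> F"
    and scale: "\<And>c \<alpha>. \<alpha> \<in> F \<Longrightarrow> cscale c \<alpha> \<in> F"
  shows "bij_betw hermite_coeffs E F"
    and "clinear_between E F hermite_coeffs"
    and "clinear_between F E (inv_into E hermite_coeffs)"
    and "\<And>\<alpha>. \<alpha> \<in> F \<Longrightarrow> inv_into E hermite_coeffs \<alpha> = hermite_synthesis \<alpha>"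
proof -
  have inj: "inj_on hermite_coeffs E"
    using inj_hermite_coeffs by (rule inj_on_subset) simp
  show "bij_betw hermite_coeffs E F"
    unfolding bij_betw_def using inj E F by (auto simp: image_iff) metis
  show "clinear_between E F hermite_coeffs"
    unfolding clinear_between_def by (simp add: E hermite_coeffs_add hermite_coeffs_cscale)
  show inv: "inv_into E hermite_coeffs \<alpha> = hermite_synthesis \<alpha>" if "\<alpha> \<in> F" for \<alpha>
    using inv_into_f_f[OF inj, of "hermite_synthesis \<alpha>"] F[OF that] by simp
  have "hermite_synthesis (\<alpha> + \<beta>) = hermite_synthesis \<alpha> + hermite_synthesis \<beta>"
    if "\<alpha> \<in> F" "\<beta> \<in> F" for \<alpha> \<beta>
    by (rule injD[OF inj_hermite_coeffs]) (simp add: F that add hermite_coeffs_add)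
  moreover have "hermite_synthesis (cscale c \<alpha>) = cscale c (hermite_synthesis \<alpha>)" if "\<alpha> \<in> F" for c \<alpha>
    by (rule injD[OF inj_hermite_coeffs]) (simp add: F that scale hermite_coeffs_cscale)
  ultimately show "clinear_between F E (inv_into E hermite_coeffs)"
    unfolding clinear_between_def by (simp add: inv F add scale)
qed

context quartered_weight
begin

lemma p_pos: "1 \<le> p"
  using K by linarith

text \<open>The levels \<open>l = 1 / j\<close> are at most 1, so
  \<open>l * \<omega> t <= t^2 + D'\<close> follows from the quadratic growth condition of a weight
  function, with one \<open>D'\<close> for all \<open>j\<close>.\<close>

lemma tame_iso_inductive_hermite:
  "tame_iso_inductive
     (S_inductive \<omega>) (\<lambda>j. S_step \<omega> (1 / real j)) (\<lambda>j. S_norm \<omega> (1 / real j))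
     (Lambda_inductive \<omega>) (\<lambda>j. Lambda_step \<omega> (1 / real j)) (\<lambda>j. Lambda_norm \<omega> (1 / real j))
     hermite_coeffs"
proof -
  note spaces = spaces_eq_steps(1,3)[OF weight]
  have "Limsup at_top (\<lambda>t. ereal (\<omega> t / t\<^sup>2)) \<le> ereal (1 / 2)"
    using weight by (simp add: weight_function_def)
  then have "Limsup at_top (\<lambda>t. ereal (\<omega> t / t\<^sup>2)) < ereal 1"
    by (rule order_le_less_trans) simp
  then obtain D' where D': "\<And>t. 0 \<le> t \<Longrightarrow> \<omega> t \<le> 1 * t\<^sup>2 + D'"
    using weight_function_le_square[OF weight, of 1] by blast
  have step: "(1 / real j) * \<omega> t \<le> t\<^sup>2 + D'" if "1 \<le> j" "0 \<le> t" for j t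
  proof -
    have "(1 / real j) * \<omega> t \<le> 1 * \<omega> t"
      using that by (intro mult_right_mono weight_function_nonneg[OF weight]) auto
    then show ?thesis
      using D'[OF that(2)] by simp
  qed
  \<comment> \<open>Dividing the level by \<open>p\<close> multiplies the index by \<open>p\<close>,
    as tameness asks.\<close>
  have eq: "1 / real j / real p = 1 / real (p * j)" for j
    by (simp add: field_simps)
  have coeffs: "\<exists>C. \<forall>f\<in>S_step \<omega> (1 / real j). hermite_coeffs f \<in> Lambda_step \<omega> (1 / real (p * j)) \<and>
      Lambda_norm \<omega> (1 / real (p * j)) (hermite_coeffs f) \<le> C * S_norm \<omega> (1 / real j) f" if "1 \<le> j" for j
    using hermite_coeffs_estimate[of "1 / real j", OF _ step[OF that]] that unfolding eq by simp
  have synthesis: "\<exists>C. \<forall>\<alpha>\<in>Lambda_step \<omega> (1 / real j).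
      hermite_synthesis \<alpha> \<in> S_step \<omega> (1 / real (p * j)) \<and> hermite_coeffs (hermite_synthesis \<alpha>) = \<alpha> \<and>
      S_norm \<omega> (1 / real (p * j)) (hermite_synthesis \<alpha>) \<le> C * Lambda_norm \<omega> (1 / real j) \<alpha>" if "1 \<le> j" for j
    using hermite_synthesis_estimate[of "1 / real j", OF _ step[OF that]] that unfolding eq by simp
  have pj: "1 \<le> p * j" if "1 \<le> j" for j
    using p_pos that mult_le_mono[of 1 p 1 j] by simp
  have E: "hermite_coeffs f \<in> Lambda_inductive \<omega>" if f: "f \<in> S_inductive \<omega>" for f
  proof -
    obtain j where j: "1 \<le> j" "f \<in> S_step \<omega> (1 / real j)"
      using f unfolding spaces by auto
    have "hermite_coeffs f \<in> Lambda_step \<omega> (1 / real (p * j))"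
      using coeffs[OF j(1)] j(2) by blast
    then show ?thesis
      using pj[OF j(1)] unfolding spaces by (intro UN_I[of "p * j"]) auto
  qed
  have F: "hermite_synthesis \<alpha> \<in> S_inductive \<omega> \<and> hermite_coeffs (hermite_synthesis \<alpha>) = \<alpha>"
    if \<alpha>': "\<alpha> \<in> Lambda_inductive \<omega>" for \<alpha>
  proof -
    obtain j where j: "1 \<le> j" "\<alpha> \<in> Lambda_step \<omega> (1 / real j)"
      using \<alpha>' unfolding spaces by auto
    have \<alpha>: "hermite_synthesis \<alpha> \<in> S_step \<omega> (1 / real (p * j))" "hermite_coeffs (hermite_synthesis \<alpha>) = \<alpha>"
      using synthesis[OF j(1)] j(2) by blast+
    have "hermite_synthesis \<alpha> \<in> S_inductive \<omega>"
      using \<alpha>(1) pj[OF j(1)] unfolding spaces by (intro UN_I[of "p * j"]) auto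
    with \<alpha>(2) show ?thesis
      by simp
  qed
  note bij = hermite_coeffs_linear_bijection[OF E F Lambda_inductive_closed[OF weight]]
  have inv: "inv_into (S_inductive \<omega>) hermite_coeffs \<alpha> = hermite_synthesis \<alpha>"
    if "1 \<le> j" "\<alpha> \<in> Lambda_step \<omega> (1 / real j)" for j \<alpha>
  proof (rule bij(4))
    show "\<alpha> \<in> Lambda_inductive \<omega>"
      unfolding spaces using that by (intro UN_I[of j]) auto
  qed
  have synthesis': "\<exists>C. \<forall>\<alpha>\<in>Lambda_step \<omega> (1 / real j).
      inv_into (S_inductive \<omega>) hermite_coeffs \<alpha> \<in> S_step \<omega> (1 / real (p * j)) \<and>
      S_norm \<omega> (1 / real (p * j)) (inv_into (S_inductive \<omega>) hermite_coeffs \<alpha>) \<le>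
        C * Lambda_norm \<omega> (1 / real j) \<alpha>" if j: "1 \<le> j" for j
  proof -
    obtain C where C: "\<And>\<alpha>. \<alpha> \<in> Lambda_step \<omega> (1 / real j) \<Longrightarrow>
        hermite_synthesis \<alpha> \<in> S_step \<omega> (1 / real (p * j)) \<and>
        S_norm \<omega> (1 / real (p * j)) (hermite_synthesis \<alpha>) \<le> C * Lambda_norm \<omega> (1 / real j) \<alpha>"
      using synthesis[OF j] by blast
    then show ?thesis
      by (intro exI[of _ C] ballI) (simp only: inv[OF j])
  qed
  show ?thesis
    unfolding tame_iso_inductive_def tame_inductive_def
    using bij(1-3) p_pos coeffs synthesis' by (intro conjI exI[of _ 1] exI[of _ p]) auto
qed

text \<open>Levels are arbitrarily large here. The vanishing limit superior is below
  \<open>1 / l\<close> for every \<open>l\<close>, so \<open>l * \<omega> t <= t^2 + O(1)\<close>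
  holds at each level, with a constant that may depend on it.\<close>

lemma tame_iso_projective_hermite:
  assumes lim: "Limsup at_top (\<lambda>t. ereal (\<omega> t / t\<^sup>2)) = 0"
  shows "tame_iso_projective
     (S_projective \<omega>) (\<lambda>j. S_norm \<omega> (real j))
     (Lambda_projective \<omega>) (\<lambda>j. Lambda_norm \<omega> (real j))
     hermite_coeffs"
proof -
  have step: "\<exists>D'. \<forall>t\<ge>0. l * \<omega> t \<le> t\<^sup>2 + D'" if l: "0 < l" for l
  proof -
    have "Limsup at_top (\<lambda>t. ereal (\<omega> t / t\<^sup>2)) < ereal (1 / l)"
      using l by (simp add: lim)
    then obtain D' where D': "\<And>t. 0 \<le> t \<Longrightarrow> \<omega> t \<le> (1 / l) * t\<^sup>2 + D'"
      using weight_function_le_square[OF weight, of "1 / l"] by blast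
    have "l * \<omega> t \<le> t\<^sup>2 + l * D'" if "0 \<le> t" for t
    proof -
      have "l * \<omega> t \<le> l * ((1 / l) * t\<^sup>2 + D')"
        using D'[OF that] l by (intro mult_left_mono) auto
      then show ?thesis
        using l by (simp add: distrib_left)
    qed
    then show ?thesis
      by blast
  qed
  have p0: "0 < real p"
    using p_pos by simp
  \<comment> \<open>The estimates start from the level \<open>p * l\<close> so as to arrive at
    \<open>l\<close>.\<close>
  have coeffs: "\<exists>C. \<forall>f\<in>S_step \<omega> (real p * l). hermite_coeffs f \<in> Lambda_step \<omega> l \<and>
      Lambda_norm \<omega> l (hermite_coeffs f) \<le> C * S_norm \<omega> (real p * l) f" if l: "0 < l" for l
  proof -
    have pl: "0 < real p * l"
      using p0 l by simp
    then obtain D' where "\<And>t. 0 \<le> t \<Longrightarrow> real p * l * \<omega> t \<le> t\<^sup>2 + D'"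
      using step by blast
    from hermite_coeffs_estimate[OF pl this] show ?thesis
      using p0 by simp
  qed
  have synthesis: "\<exists>C. \<forall>\<alpha>\<in>Lambda_step \<omega> (real p * l). hermite_synthesis \<alpha> \<in> S_step \<omega> l \<and>
      hermite_coeffs (hermite_synthesis \<alpha>) = \<alpha> \<and>
      S_norm \<omega> l (hermite_synthesis \<alpha>) \<le> C * Lambda_norm \<omega> (real p * l) \<alpha>" if l: "0 < l" for l
  proof -
    have pl: "0 < real p * l"
      using p0 l by simp
    then obtain D' where "\<And>t. 0 \<le> t \<Longrightarrow> real p * l * \<omega> t \<le> t\<^sup>2 + D'"
      using step by blast
    from hermite_synthesis_estimate[OF pl this] show ?thesis
      using p0 by simp
  qed
  have S: "f \<in> S_step \<omega> (real p * l)" if "f \<in> S_projective \<omega>" "0 < l" for f l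
    using that p0 unfolding S_projective_def by simp
  have L: "\<alpha> \<in> Lambda_step \<omega> (real p * l)" if "\<alpha> \<in> Lambda_projective \<omega>" "0 < l" for \<alpha> l
    using that p0 unfolding Lambda_projective_def by simp
  have E: "hermite_coeffs f \<in> Lambda_projective \<omega>" if "f \<in> S_projective \<omega>" for f
    unfolding Lambda_projective_def using coeffs S[OF that] by blast
  have F: "hermite_synthesis \<alpha> \<in> S_projective \<omega> \<and> hermite_coeffs (hermite_synthesis \<alpha>) = \<alpha>"
    if "\<alpha> \<in> Lambda_projective \<omega>" for \<alpha>
    \<comment> \<open>\<open>zero_less_one\<close> provides a level at which the identity for the
      coefficients can be read off.\<close>
    unfolding S_projective_def using synthesis L[OF that] zero_less_one by blast
  note bij = hermite_coeffs_linear_bijection[OF E F Lambda_projective_closed]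
  have coeffs': "\<exists>C. \<forall>f\<in>S_projective \<omega>.
      Lambda_norm \<omega> (real j) (hermite_coeffs f) \<le> C * S_norm \<omega> (real (p * j)) f" if "1 \<le> j" for j
  proof -
    have j: "0 < real j"
      using that by simp
    show ?thesis
      using coeffs[OF j] S[OF _ j] unfolding of_nat_mult by blast
  qed
  have synthesis': "\<exists>C. \<forall>\<alpha>\<in>Lambda_projective \<omega>.
      S_norm \<omega> (real j) (inv_into (S_projective \<omega>) hermite_coeffs \<alpha>) \<le>
        C * Lambda_norm \<omega> (real (p * j)) \<alpha>" if "1 \<le> j" for j
  proof -
    have j: "0 < real j"
      using that by simp
    obtain C where "\<And>\<alpha>. \<alpha> \<in> Lambda_step \<omega> (real p * real j) \<Longrightarrow>
        S_norm \<omega> (real j) (hermite_synthesis \<alpha>) \<le> C * Lambda_norm \<omega> (real p * real j) \<alpha>"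
      using synthesis[OF j] by blast
    then show ?thesis
      using L[OF _ j] by (intro exI[of _ C]) (simp add: bij(4))
  qed
  show ?thesis
    unfolding tame_iso_projective_def tame_projective_def
    using bij(1-3) p_pos coeffs' synthesis' by (intro conjI exI[of _ 1] exI[of _ p]) auto
qed

end

theorem theorem1:
  fixes \<omega> :: "real \<Rightarrow> real"
  assumes "weight_function \<omega>"
  shows
    "(Limsup at_top (\<lambda>t. ereal (\<omega> t / t\<^sup>2)) < \<infinity> \<longrightarrow>
       tame_iso_inductive
         (S_inductive \<omega>) (\<lambda>j. S_step \<omega> (1 / real j)) (\<lambda>j. S_norm \<omega> (1 / real j))
         (Lambda_inductive \<omega>) (\<lambda>j. Lambda_step \<omega> (1 / real j)) (\<lambda>j. Lambda_norm \<omega> (1 / real j))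
         hermite_coeffs) \<and>
     (Limsup at_top (\<lambda>t. ereal (\<omega> t / t\<^sup>2)) = 0 \<longrightarrow>
       tame_iso_projective
         (S_projective \<omega>) (\<lambda>j. S_norm \<omega> (real j))
         (Lambda_projective \<omega>) (\<lambda>j. Lambda_norm \<omega> (real j))
         hermite_coeffs)"
proof -
  obtain K D where K: "1 \<le> K" and D: "\<And>t. 0 \<le> t \<Longrightarrow> \<omega> t \<le> K * \<omega> (t / 4) + D"
    using weight_function_quarter[OF assms] by blast
  \<comment> \<open>\<open>K\<close>, and hence \<open>p\<close>, is chosen from the weight alone:
    one tameness constant serves both parts.\<close>
  obtain p :: nat where p: "8 * K \<le> real p"
    using real_arch_simple by blast
  interpret quartered_weight \<omega> K D p
    by standard (use assms K D p in auto)
  show ?thesis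
    using tame_iso_inductive_hermite tame_iso_projective_hermite by blast
qed

end
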